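(* Let $\sigma>0$, $\bar\gamma>0$, $c_\infty\ge0$, and for $\gamma\in(0,\bar\gamma]$ let $\tau_\gamma:[0,\infty)\to[0,\infty)$ be non-decreasing with $\tau_\gamma(0)=0$, such that there exist $R_1,L\ge0$, $m>0$ with $\sup_{r>0}\tau_\gamma(r)/r\le1+\gamma L$ and $\sup_{r>R_1}\tau_\gamma(r)/r\le1-\gamma m$ for all $\gamma\in(0,\bar\gamma]$. Let $Q_\gamma$ be the Markov kernel on $[0,\infty)$ $$Q_\gamma(w,A)=\delta_0(A)\int_{\mathbb{R}}\bar p_{\sigma^2\gamma}(\tau_\gamma(w)+\gamma c_\infty,g)\varphi(g)dg+\int_{\mathbb{R}}\mathbb{1}_A(\tau_\gamma(w)+\gamma c_\infty-2\sigma\gamma^{1/2}g)\{1-\bar p_{\sigma^2\gamma}(\tau_\gamma(w)+\gamma c_\infty,g)\}\varphi(g)dg,$$ with $\bar p_{\sigma^2\gamma}(a,g)=1\wedge\varphi_{\sigma^2\gamma}(a-\sigma\sqrt\gamma g)/\varphi_{\sigma^2\gamma}(\sigma\sqrt\gamma g)$, and let $\mu_\gamma$ be its unique invariant probability measure. Let $\zeta=2(1+\bar\gamma L)^2\sigma^2(2\sqrt{2\pi})^{-1}[\sup_{t\ge0}\{t^2\Phi(-t)\}+1/8]$. Then for any $\bar\delta\in(0,\{L^{-1}\wedge(\sigma e^{-1}/c_\infty)^2\}]$ (with the convention $1/0=+\infty$) and any $\gamma\in(0,\bar\gamma]$, $$\int_{[0,\infty)}w\,\mu_\gamma(dw)\le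 c_\infty c_1,\qquad \mu_\gamma((0,+\infty))\le c_\infty c_2,$$ where $$\eta_1=[\bar\delta+\bar\gamma]^{1/2}\Big[\frac{2\zeta e^{3(\bar\delta+\bar\gamma)L}}{\sigma^3}+\frac{e^{(\bar\delta+\bar\gamma)L}}{2\sqrt{2\pi}\sigma}\Big]\Big/\Phi\Big(-\frac{(1+\bar\gamma L)R_1+(\bar\delta+\bar\gamma)c_\infty}{2\bar\delta^{1/2}\sigma e^{-(\bar\delta+\bar\gamma)L}}\Big),$$ $$c_1=\eta_1R_1(1+L/m)+1/m,\qquad c_2=e^{(\bar\delta+\bar\gamma)L}\big(c_1(1+\bar\gamma L)/\bar\delta^{1/2}+[\bar\delta+\bar\gamma]^{1/2}\big)/(\sqrt{2\pi}\sigma)+2\zeta[\bar\delta+\bar\gamma]^{1/2}e^{3(\bar\delta+\bar\gamma)L}/\sigma^3.$$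
   Context: $\varphi$ and $\Phi$ are the standard normal density and distribution function; $\varphi_s(t)=(2\pi s)^{-1/2}e^{-t^2/(2s)}$. *)

theory Defs
  imports "HOL-Probability.Probability"
begin

definition std_phi :: "real \<Rightarrow> real" where
  "std_phi t = exp (- (t^2) / 2) / sqrt (2 * pi)"

definition std_Phi :: "real \<Rightarrow> real" where
  "std_Phi x = (LINT t:{..x}|lborel. std_phi t)"

definition phi_var :: "real \<Rightarrow> real \<Rightarrow> real" where
  "phi_var s t = exp (- (t^2) / (2 * s)) / sqrt (2 * pi * s)"

definition pbar :: "real \<Rightarrow> real \<Rightarrow> real \<Rightarrow> real \<Rightarrow> real" where
  "pbar \<sigma> \<gamma> a g = min 1 (phi_var (\<sigma>^2 * \<gamma>) (a - \<sigma> * sqrt \<gamma> * g) / phi_var (\<sigma>^2 * \<gamma>) (\<sigma> * sqrt \<gamma> * g))"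

definition Qker :: "real \<Rightarrow> real \<Rightarrow> real \<Rightarrow> (real \<Rightarrow> real) \<Rightarrow> real \<Rightarrow> real set \<Rightarrow> real" where
  "Qker \<sigma> cinf \<gamma> \<tau> w A =
     (let a = \<tau> w + \<gamma> * cinf in
        indicator A 0 * (LINT g|lborel. pbar \<sigma> \<gamma> a g * std_phi g)
      + (LINT g|lborel. indicator A (a - 2 * \<sigma> * sqrt \<gamma> * g) * (1 - pbar \<sigma> \<gamma> a g) * std_phi g))"

definition invariant_prob :: "real \<Rightarrow> real \<Rightarrow> real \<Rightarrow> (real \<Rightarrow> real) \<Rightarrow> real measure \<Rightarrow> bool" where
  "invariant_prob \<sigma> cinf \<gamma> \<tau> \<mu> \<longleftrightarrow>
     prob_space \<mu> \<and> sets \<mu> = sets borel \<and> emeasure \<mu> {..<0} = 0 \<and>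
     (\<forall>A\<in>sets borel. measure \<mu> A = (LINT w|\<mu>. Qker \<sigma> cinf \<gamma> \<tau> w A))"

definition zeta :: "real \<Rightarrow> real \<Rightarrow> real \<Rightarrow> real" where
  "zeta \<sigma> \<gamma>b L = 2 * (1 + \<gamma>b * L)^2 * \<sigma>^2 / (2 * sqrt (2 * pi))
     * (Sup ((\<lambda>t. t^2 * std_Phi (- t)) ` {0..}) + 1/8)"

definition eta1 :: "real \<Rightarrow> real \<Rightarrow> real \<Rightarrow> real \<Rightarrow> real \<Rightarrow> real \<Rightarrow> real" where
  "eta1 \<sigma> \<gamma>b L R1 cinf \<delta> =
     sqrt (\<delta> + \<gamma>b) * (2 * zeta \<sigma> \<gamma>b L * exp (3 * (\<delta> + \<gamma>b) * L) / \<sigma>^3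
        + exp ((\<delta> + \<gamma>b) * L) / (2 * sqrt (2 * pi) * \<sigma>))
     / std_Phi (- (((1 + \<gamma>b * L) * R1 + (\<delta> + \<gamma>b) * cinf)
                   / (2 * sqrt \<delta> * \<sigma> * exp (- (\<delta> + \<gamma>b) * L))))"

definition const_c1 :: "real \<Rightarrow> real \<Rightarrow> real \<Rightarrow> real \<Rightarrow> real \<Rightarrow> real \<Rightarrow> real \<Rightarrow> real" where
  "const_c1 \<sigma> \<gamma>b L m R1 cinf \<delta> = eta1 \<sigma> \<gamma>b L R1 cinf \<delta> * R1 * (1 + L / m) + 1 / m"

definition const_c2 :: "real \<Rightarrow> real \<Rightarrow> real \<Rightarrow> real \<Rightarrow> real \<Rightarrow> real \<Rightarrow> real \<Rightarrow> real" where
  "const_c2 \<sigma> \<gamma>b L m R1 cinf \<delta> =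
     exp ((\<delta> + \<gamma>b) * L) * (const_c1 \<sigma> \<gamma>b L m R1 cinf \<delta> * (1 + \<gamma>b * L) / sqrt \<delta> + sqrt (\<delta> + \<gamma>b))
       / (sqrt (2 * pi) * \<sigma>)
     + 2 * zeta \<sigma> \<gamma>b L * sqrt (\<delta> + \<gamma>b) * exp (3 * (\<delta> + \<gamma>b) * L) / \<sigma>^3"

end

theory Submission
  imports Defs
begin

text \<open>
  Extend test functions on \<open>[0,\<infinity>)\<close> with \<open>f 0 = 0\<close> to odd functions on the line. The kernel then
  acts as a Gaussian average, \<open>Q f w = E[f (\<tau> w + \<gamma> * cinf - 2 * \<sigma> * sqrt \<gamma> * G)]\<close>, because the
  absorbed part of the Gaussian density, \<open>min (\<phi> g) (\<phi> (g - a / (\<sigma> * sqrt \<gamma>)))\<close> with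
  \<open>a = \<tau> w + \<gamma> * cinf\<close>, is symmetric about the zero of \<open>a - 2 * \<sigma> * sqrt \<gamma> * g\<close>. Invariance of \<open>\<mu>\<close> thus turns
  every upper bound on such an average into an integral inequality for \<open>\<mu>\<close>.

  For \<open>f w = w\<close> this is the balance \<open>E w = E (\<tau> w) + \<gamma> * cinf\<close>, so that the contraction outside \<open>[0, R1]\<close>
  bounds the first moment in terms of \<open>\<mu> (0, R1]\<close>. For \<open>f w = 2 * Phi (w / (2 * S)) - 1\<close> the average is
  again of this form with \<open>S\<^sup>2\<close> increased by \<open>\<sigma>\<^sup>2 * \<gamma>\<close>; starting from \<open>sgn\<close> and adding up about
  \<open>\<delta> / \<gamma>\<close> steps, each of which costs a multiple of \<open>cinf\<close>, bounds \<open>\<mu> (0, R1]\<close>.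

  Iterating in the same way is too lossy for \<open>\<mu> (0,\<infinity>)\<close>. There the sum of \<open>sgn\<close> and a concave, piecewise
  cubic function is used, whose decrease in one step is at least \<open>1 - w / l\<close> for \<open>w > 0\<close>, up to terms of
  order \<open>\<gamma> * L\<close>; with \<open>l = \<sigma> * sqrt (2 * pi * \<delta>)\<close> the resulting bound has the constant \<open>pi / 2\<close>, and the
  numerical fact that makes it suffice is \<open>pi / 2 \<le> 1 + 2 * (sup (t\<^sup>2 * Phi (- t)) + 1 / 8)\<close>. When \<open>\<delta>\<close> is
  at most \<open>\<gamma> * exp (2 * (\<delta> + \<gamma>b) * L)\<close>, a single step from \<open>sgn\<close> is enough.
\<close>

section \<open>The standard normal distribution\<close>

abbreviation gauss :: "real measure" where
  "gauss \<equiv> density lborel (\<lambda>x. ennreal (std_phi x))"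

lemma std_phi_eq_normal_density: "std_phi = std_normal_density"
  by (auto simp: fun_eq_iff std_phi_def std_normal_density_def)

lemma std_phi_nonneg [simp]: "0 \<le> std_phi x"
  by (simp add: std_phi_def)

lemma std_phi_pos [simp]: "0 < std_phi x"
  by (simp add: std_phi_def)

lemma std_phi_minus [simp]: "std_phi (- x) = std_phi x"
  by (simp add: std_phi_def)

lemma borel_measurable_std_phi [measurable]: "std_phi \<in> borel_measurable borel"
  by (simp add: std_phi_eq_normal_density)

lemma prob_space_gauss: "prob_space gauss"
  unfolding std_phi_eq_normal_density by (rule prob_space_normal_density) simp

interpretation gauss: prob_space gauss
  by (rule prob_space_gauss)

lemma std_phi_le_iff: "std_phi x \<le> std_phi y \<longleftrightarrow> \<bar>y\<bar> \<le> \<bar>x\<bar>"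
  by (auto simp: std_phi_def divide_le_cancel abs_le_square_iff)

lemma DERIV_std_phi: "(std_phi has_real_derivative - x * std_phi x) (at x)"
  unfolding std_phi_def by (auto intro!: derivative_eq_intros simp: field_simps)

lemma integral_gauss_eq:
  fixes f :: "real \<Rightarrow> real"
  assumes [measurable]: "f \<in> borel_measurable borel"
  shows "(LINT g|gauss. f g) = (LINT g|lborel. f g * std_phi g)"
  by (subst integral_density) (auto simp: mult.commute)

lemma integrable_gauss_iff:
  fixes f :: "real \<Rightarrow> real"
  assumes [measurable]: "f \<in> borel_measurable borel"
  shows "integrable gauss f \<longleftrightarrow> integrable lborel (\<lambda>g. f g * std_phi g)"
  by (subst integrable_density) (auto simp: mult.commute)

lemma integrable_gauss_bounded:
  fixes f :: "real \<Rightarrow> real"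
  assumes "f \<in> borel_measurable borel" "\<And>x. \<bar>f x\<bar> \<le> B"
  shows "integrable gauss f"
  by (rule gauss.integrable_const_bound[of _ B]) (use assms in auto)

lemma std_Phi_eq_measure: "std_Phi x = measure gauss {..x}"
proof -
  have "measure gauss {..x} = (LINT g|gauss. indicator {..x} g)"
    by simp
  also have "\<dots> = (LINT g|lborel. indicator {..x} g * std_phi g)"
    by (rule integral_gauss_eq) simp
  finally show ?thesis
    by (simp add: std_Phi_def set_lebesgue_integral_def)
qed

lemma std_Phi_mono: "x \<le> y \<Longrightarrow> std_Phi x \<le> std_Phi y"
  unfolding std_Phi_eq_measure by (intro gauss.finite_measure_mono) auto

lemma std_Phi_diff:
  assumes "a \<le> b"
  shows "std_Phi b - std_Phi a = (LINT x:{a..b}|lborel. std_phi x)"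
proof -
  have *: "emeasure gauss {x} = 0" for x
  proof -
    have "emeasure gauss {x} = (\<integral>\<^sup>+ g. ennreal (std_phi g) * indicator {x} g \<partial>lborel)"
      by (rule emeasure_density) auto
    also have "\<dots> = 0"
      using AE_lborel_singleton[of x] by (auto simp: nn_integral_0_iff_AE indicator_def elim: eventually_mono)
    finally show ?thesis .
  qed
  have "std_Phi b - std_Phi a = measure gauss ({..b} - {..a})"
    unfolding std_Phi_eq_measure using assms by (intro gauss.finite_measure_Diff[symmetric]) auto
  also have "\<dots> = measure gauss {a..b}"
  proof (rule gauss.finite_measure_eq_AE)
    have "AE x in gauss. x \<noteq> a"
      by (rule AE_I[of _ _ "{a}"]) (use * in auto)
    then show "AE x in gauss. (x \<in> {..b} - {..a}) = (x \<in> {a..b})"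
      by eventually_elim auto
  qed auto
  also have "\<dots> = (LINT g|gauss. indicator {a..b} g)"
    by simp
  also have "\<dots> = (LINT g|lborel. indicator {a..b} g * std_phi g)"
    by (rule integral_gauss_eq) simp
  finally show ?thesis
    by (simp add: set_lebesgue_integral_def)
qed

lemma isCont_std_phi: "isCont std_phi x"
  using DERIV_std_phi by (rule DERIV_isCont)

lemma DERIV_std_Phi: "(std_Phi has_real_derivative std_phi x) (at x)"
proof -
  \<comment> \<open>The base point \<open>x - 1\<close> is arbitrary. It makes \<open>x\<close> an
    interior point, so that the derivative within the interval is a two-sided one.\<close>
  have "((\<lambda>u. LBINT y=x - 1..u. std_phi y) has_vector_derivative std_phi x) (at x within {x - 1..x + 1})"
    by (rule interval_integral_FTC2)
       (auto intro!: continuous_at_imp_continuous_on isCont_std_phi)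
  then have "((\<lambda>u. LBINT y=x - 1..u. std_phi y) has_real_derivative std_phi x) (at x)"
    by (subst (asm) at_within_interior[of x "{x - 1..x + 1}"]) (auto simp: has_real_derivative_iff_has_vector_derivative)
  then have "((\<lambda>u. std_Phi (x - 1) + (LBINT y=x - 1..u. std_phi y)) has_real_derivative std_phi x) (at x)"
    by (auto intro!: derivative_eq_intros)
  moreover have "eventually (\<lambda>u. u \<in> {x - 1<..}) (nhds x)"
    by (intro eventually_nhds_in_open) auto
  then have "eventually (\<lambda>u. std_Phi (x - 1) + (LBINT y=x - 1..u. std_phi y) = std_Phi u) (nhds x)"
  proof eventually_elim
    case (elim u)
    then show ?case
      using std_Phi_diff[of "x - 1" u] by (simp add: interval_integral_Icc)
  qed
  ultimately show ?thesis
    by (subst (asm) DERIV_cong_ev[OF refl _ refl]) auto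
qed

lemma integral_gauss_minus:
  fixes f :: "real \<Rightarrow> real"
  assumes [measurable]: "f \<in> borel_measurable borel"
  shows "(LINT g|gauss. f (- g)) = (LINT g|gauss. f g)"
  using lborel_integral_real_affine[of "-1" "\<lambda>g. f g * std_phi g" 0]
  by (simp add: integral_gauss_eq)

text \<open>By evenness of the density, \<open>std_Phi y + std_Phi (- y)\<close> has derivative
  zero. Its constant value is read off along the integers, from continuity of the measure.\<close>

lemma std_Phi_minus: "std_Phi (- x) = 1 - std_Phi x"
proof -
  have *: "(\<lambda>y. std_Phi y + std_Phi (- y)) a = (\<lambda>y. std_Phi y + std_Phi (- y)) b" for a b
    by (rule DERIV_isconst_all)
       (auto intro!: derivative_eq_intros DERIV_std_Phi[THEN DERIV_chain2])
  have 1: "(\<lambda>n. std_Phi (real n)) \<longlonglongrightarrow> 1"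
  proof -
    have "(\<lambda>n. measure gauss {..real n}) \<longlonglongrightarrow> measure gauss (\<Union>n. {..real n})"
      by (intro gauss.finite_Lim_measure_incseq) (auto simp: incseq_def)
    also have "(\<Union>n. {..real n}) = UNIV"
      by (auto intro: real_arch_simple)
    finally show ?thesis
      using gauss.prob_space by (simp add: std_Phi_eq_measure)
  qed
  have 2: "(\<lambda>n. std_Phi (- real n)) \<longlonglongrightarrow> 0"
  proof -
    have "(\<lambda>n. measure gauss {..- real n}) \<longlonglongrightarrow> measure gauss (\<Inter>n. {..- real n})"
      by (intro gauss.finite_Lim_measure_decseq) (auto simp: decseq_def)
    also have "(\<Inter>n. {..- real n}) = {}"
    proof -
      have "\<exists>n. \<not> y \<le> - real n" for y
        using reals_Archimedean2[of "- y"] by (auto simp: not_le) (metis minus_less_iff)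
      then show ?thesis by auto
    qed
    finally show ?thesis
      by (simp add: std_Phi_eq_measure)
  qed
  have "(\<lambda>n. std_Phi (real n) + std_Phi (- real n)) \<longlonglongrightarrow> 1 + 0"
    by (intro tendsto_add 1 2)
  moreover have "(\<lambda>n. std_Phi (real n) + std_Phi (- real n)) = (\<lambda>n. std_Phi x + std_Phi (- x))"
    using * by (auto simp: fun_eq_iff)
  ultimately have "std_Phi x + std_Phi (- x) = 1"
    by (simp add: LIMSEQ_const_iff)
  then show ?thesis by simp
qed

lemma std_Phi_nonneg [simp]: "0 \<le> std_Phi x"
  by (simp add: std_Phi_eq_measure)

lemma std_Phi_le_1 [simp]: "std_Phi x \<le> 1"
  using std_Phi_minus[of x] std_Phi_nonneg[of "- x"] by linarith

lemma std_Phi_strict_mono: "x < y \<Longrightarrow> std_Phi x < std_Phi y"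
  by (rule DERIV_pos_imp_increasing[of x y std_Phi]) (use DERIV_std_Phi std_phi_pos in blast)+

lemma std_Phi_pos [simp]: "0 < std_Phi x"
  using std_Phi_strict_mono[of "x - 1" x] std_Phi_nonneg[of "x - 1"] by linarith

lemma std_Phi_0 [simp]: "std_Phi 0 = 1/2"
  using std_Phi_minus[of 0] by simp

lemma borel_measurable_std_Phi [measurable]: "std_Phi \<in> borel_measurable borel"
  by (intro borel_measurable_mono) (auto simp: mono_def std_Phi_mono)

section \<open>Gaussian averages of odd functions\<close>

text \<open>For \<open>x \<ge> 0\<close> this is the probability that a standard normal variable
  lies in \<open>[- x, x]\<close>, that is erf(x / sqrt 2). It is the odd function into which
  Gaussian averaging turns \<open>sgn\<close>.\<close>

definition std_Psi :: "real \<Rightarrow> real" where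
  "std_Psi x = 2 * std_Phi x - 1"

lemma std_Psi_minus: "std_Psi (- x) = - std_Psi x"
  by (simp add: std_Psi_def std_Phi_minus)

lemma std_Psi_0 [simp]: "std_Psi 0 = 0"
  by (simp add: std_Psi_def)

lemma std_Psi_mono: "x \<le> y \<Longrightarrow> std_Psi x \<le> std_Psi y"
  by (simp add: std_Psi_def std_Phi_mono)

lemma std_Psi_le_1: "std_Psi x \<le> 1"
  by (simp add: std_Psi_def)

lemma abs_std_Psi_le_1: "\<bar>std_Psi x\<bar> \<le> 1"
  unfolding std_Psi_def abs_le_iff using std_Phi_nonneg[of x] std_Phi_le_1[of x] by linarith

lemma borel_measurable_std_Psi [measurable]: "std_Psi \<in> borel_measurable borel"
  unfolding std_Psi_def by measurable

lemma DERIV_std_Psi: "(std_Psi has_real_derivative 2 * std_phi x) (at x)"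
  unfolding std_Psi_def by (auto intro!: derivative_eq_intros DERIV_std_Phi)

text \<open>This is concavity on the half-line: the derivative \<open>2 * std_phi\<close> decreases
  there, so the tangent at the left end lies above.\<close>

lemma std_Psi_diff_le:
  assumes "0 \<le> x" "x \<le> y"
  shows "std_Psi y - std_Psi x \<le> (y - x) * (2 * std_phi x)"
proof (cases "x = y")
  case False
  then have "x < y" using assms by simp
  then obtain z where "x < z" "z < y" "std_Psi y - std_Psi x = (y - x) * (2 * std_phi z)"
    using MVT2[of x y std_Psi "\<lambda>z. 2 * std_phi z"] DERIV_std_Psi by blast
  moreover from this have "std_phi z \<le> std_phi x"
    using assms by (simp add: std_phi_le_iff)
  ultimately show ?thesis
    using assms by (simp add: mult_left_mono)
qed simp

lemma std_Psi_increment_le: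
  assumes "0 \<le> x" "0 \<le> e"
  shows "std_Psi (x + e) \<le> std_Psi x + e * (2 * std_phi 0)"
proof -
  have "std_Psi (x + e) - std_Psi x \<le> e * (2 * std_phi x)"
    using std_Psi_diff_le[of x "x + e"] assms by simp
  also have "\<dots> \<le> e * (2 * std_phi 0)"
    using assms by (intro mult_left_mono) (auto simp: std_phi_le_iff)
  finally show ?thesis by simp
qed

lemma abs_mult_std_phi_le: "\<bar>x\<bar> * std_phi x \<le> 1 / sqrt (2 * pi)"
proof -
  have "\<bar>x\<bar> \<le> 1 + x\<^sup>2 / 2"
    using sum_squares_bound[of "\<bar>x\<bar>" 1] by (simp add: power2_eq_square)
  also have "\<dots> \<le> exp (x\<^sup>2 / 2)"
    by (rule exp_ge_add_one_self)
  finally have "\<bar>x\<bar> * exp (- (x\<^sup>2 / 2)) \<le> 1"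
    by (simp add: exp_minus field_simps)
  then show ?thesis
    by (simp add: std_phi_def divide_right_mono)
qed

text \<open>The derivative \<open>- z * std_phi z\<close> is bounded by 1. This is the regularity
  that differentiation under the integral requires below.\<close>

lemma std_phi_lipschitz: "\<bar>std_phi x - std_phi y\<bar> \<le> \<bar>x - y\<bar>"
proof -
  have "\<bar>- z * std_phi z\<bar> \<le> 1" for z
  proof -
    have "1 \<le> sqrt (2 * pi)" using pi_gt3 by simp
    then have "1 / sqrt (2 * pi) \<le> 1" by simp
    then show ?thesis
      using abs_mult_std_phi_le[of z] by (simp only: abs_mult abs_minus_cancel abs_of_nonneg[OF std_phi_nonneg])
  qed
  then have "norm (std_phi x - std_phi y) \<le> 1 * norm (x - y)"
    by (intro field_differentiable_bound[of UNIV std_phi "\<lambda>z. - z * std_phi z"])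
       (use DERIV_std_phi in auto)
  then show ?thesis by simp
qed

text \<open>A Lipschitz derivative gives a Taylor remainder of at most \<open>C * h^2\<close>,
  uniformly in the base point. Integrating it shows that the difference quotient is within
  \<open>C * \<bar>h\<bar>\<close> of its limit, without dominated convergence.\<close>

lemma DERIV_integral_translate:
  fixes f p :: "real \<Rightarrow> real" and Y :: "'a \<Rightarrow> real"
  assumes "prob_space M"
    and f: "\<And>x. (f has_real_derivative p x) (at x)"
    and p: "\<And>x y. \<bar>p x - p y\<bar> \<le> C * \<bar>x - y\<bar>"
    and int_f: "\<And>x. integrable M (\<lambda>\<omega>. f (x + Y \<omega>))"
    and int_p: "\<And>x. integrable M (\<lambda>\<omega>. p (x + Y \<omega>))"
  shows "((\<lambda>x. \<integral>\<omega>. f (x + Y \<omega>) \<partial>M) has_real_derivative (\<integral>\<omega>. p (x + Y \<omega>) \<partial>M)) (at x)"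
proof -
  interpret prob_space M by fact
  define U where "U x = (\<integral>\<omega>. f (x + Y \<omega>) \<partial>M)" for x
  define D where "D = (\<integral>\<omega>. p (x + Y \<omega>) \<partial>M)"
  have taylor: "\<bar>f (u + h) - f u - h * p u\<bar> \<le> C * h\<^sup>2" for u h
  proof (cases "h = 0")
    case False
    obtain z where z: "\<bar>z - u\<bar> \<le> \<bar>h\<bar>" "f (u + h) - f u = h * p z"
    proof (cases "h > 0")
      case True
      then obtain z where "u < z" "z < u + h" "f (u + h) - f u = (u + h - u) * p z"
        using MVT2[of u "u + h" f p] f by auto
      then show thesis by (intro that[of z]) auto
    next
      case False
      then obtain z where "u + h < z" "z < u" "f u - f (u + h) = (u - (u + h)) * p z"
        using MVT2[of "u + h" u f p] f \<open>h \<noteq> 0\<close> by auto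
      then show thesis by (intro that[of z]) (auto simp: algebra_simps)
    qed
    have C: "0 \<le> C"
      using p[of 1 0] by (simp add: order_trans[OF abs_ge_zero])
    have "\<bar>f (u + h) - f u - h * p u\<bar> = \<bar>h\<bar> * \<bar>p z - p u\<bar>"
      unfolding z abs_mult[symmetric] by (simp add: right_diff_distrib)
    also have "\<dots> \<le> \<bar>h\<bar> * (C * \<bar>h\<bar>)"
      using p[of z u] mult_left_mono[OF z(1) C] by (intro mult_left_mono) auto
    finally show ?thesis by (simp add: power2_eq_square ac_simps)
  qed auto
  have bound: "\<bar>(U (x + h) - U x) / h - D\<bar> \<le> C * \<bar>h\<bar>" if "h \<noteq> 0" for h
  proof -
    have "U (x + h) - U x - h * D = (\<integral>\<omega>. f ((x + Y \<omega>) + h) - f (x + Y \<omega>) - h * p (x + Y \<omega>) \<partial>M)"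
      using int_f[of "x + h"] int_f[of x] int_p[of x] by (simp add: U_def D_def ac_simps)
    also have "\<bar>\<dots>\<bar> \<le> (\<integral>\<omega>. \<bar>f ((x + Y \<omega>) + h) - f (x + Y \<omega>) - h * p (x + Y \<omega>)\<bar> \<partial>M)"
      by (rule integral_abs_bound)
    also have "\<dots> \<le> (\<integral>\<omega>. C * h\<^sup>2 \<partial>M)"
      using int_f[of "x + h"] int_f[of x] int_p[of x]
      by (intro integral_mono taylor integrable_abs Bochner_Integration.integrable_diff) (auto simp: ac_simps)
    also have "\<dots> = C * h\<^sup>2"
      by (simp add: prob_space)
    finally have *: "\<bar>U (x + h) - U x - h * D\<bar> \<le> C * h\<^sup>2" .
    have "\<bar>(U (x + h) - U x) / h - D\<bar> = \<bar>U (x + h) - U x - h * D\<bar> / \<bar>h\<bar>"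
      using that by (simp add: abs_divide[symmetric] diff_divide_distrib)
    also have "\<dots> \<le> C * h\<^sup>2 / \<bar>h\<bar>"
      using * by (intro divide_right_mono) auto
    also have "\<dots> = C * \<bar>h\<bar>"
      using that by (simp add: field_simps power2_eq_square)
    finally show ?thesis .
  qed
  have "((\<lambda>h. (U (x + h) - U x) / h - D) \<longlongrightarrow> 0) (at 0)"
  proof (rule Lim_null_comparison)
    show "eventually (\<lambda>h. norm ((U (x + h) - U x) / h - D) \<le> C * \<bar>h\<bar>) (at 0)"
      using bound by (auto simp: eventually_at_filter)
    show "((\<lambda>h. C * \<bar>h\<bar>) \<longlongrightarrow> 0) (at 0)"
      by (rule tendsto_eq_intros refl | simp)+
  qed
  then have "((\<lambda>h. (U (x + h) - U x) / h) \<longlongrightarrow> D) (at 0)"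
    by (simp add: LIM_zero_iff)
  then show ?thesis
    by (simp add: DERIV_def U_def D_def)
qed

text \<open>Reflecting the Gaussian variable at \<open>a / c\<close> maps \<open>f (a - c * g)\<close> to its negative and
  leaves the minimum of the two densities invariant.\<close>

lemma integral_odd_min_eq_0:
  fixes f :: "real \<Rightarrow> real"
  assumes odd: "\<And>x. f (- x) = - f x" and "c \<noteq> 0"
  shows "(LINT g|lborel. f (a - c * g) * min (std_phi g) (std_phi (g - 2 * a / c))) = 0"
    (is "integral\<^sup>L lborel ?h = 0")
proof -
  have "?h (2 * a / c + (- 1) * g) = - ?h g" for g
  proof -
    have 1: "a - c * (2 * a / c + - 1 * g) = - (a - c * g)"
      using \<open>c \<noteq> 0\<close> by (simp add: field_simps)
    have 2: "std_phi (2 * a / c + - 1 * g) = std_phi (g - 2 * a / c)"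
      using std_phi_minus[of "g - 2 * a / c"] by simp
    have 3: "std_phi (2 * a / c + - 1 * g - 2 * a / c) = std_phi g"
      by simp
    show ?thesis
      unfolding 1 2 3 odd by (simp add: min.commute)
  qed
  then have "integral\<^sup>L lborel ?h = - integral\<^sup>L lborel ?h"
    using lborel_integral_real_affine[of "-1" ?h "2 * a / c"] by simp
  then show ?thesis by simp
qed

text \<open>For \<open>c = 2 * s\<close> the weight on the right is the part of the Gaussian density
  that is not absorbed at 0. Hence absorption does not change the average of an odd
  function.\<close>

lemma integral_gauss_odd:
  fixes f :: "real \<Rightarrow> real"
  assumes odd: "\<And>x. f (- x) = - f x" and "c \<noteq> 0"
    and [measurable]: "f \<in> borel_measurable borel"
    and int: "integrable gauss (\<lambda>g. f (a - c * g))"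
  shows "(LINT g|gauss. f (a - c * g)) =
    (LINT g|lborel. f (a - c * g) * (std_phi g - min (std_phi g) (std_phi (g - 2 * a / c))))"
proof -
  have int1: "integrable lborel (\<lambda>g. f (a - c * g) * std_phi g)"
    using int by (subst (asm) integrable_gauss_iff) auto
  have int2: "integrable lborel (\<lambda>g. f (a - c * g) * min (std_phi g) (std_phi (g - 2 * a / c)))"
    by (rule Bochner_Integration.integrable_bound[OF int1])
       (auto simp: abs_mult intro!: mult_left_mono)
  show ?thesis
    using int1 int2 integral_odd_min_eq_0[of f c a, OF odd \<open>c \<noteq> 0\<close>]
    by (simp add: integral_gauss_eq right_diff_distrib)
qed

lemma reflected_point_le:
  fixes a c g :: real
  assumes "0 < c" "0 \<le> a" "a < c * g"
  shows "\<bar>g - 2 * a / c\<bar> \<le> \<bar>g\<bar>"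
proof -
  have "a / c < g" "0 \<le> a / c" using assms by (auto simp: field_simps)
  then show ?thesis by auto
qed

text \<open>Where \<open>a - c * g\<close> is negative, the reflected point is no farther from 0
  than \<open>g\<close>, so the minimum of the densities is \<open>std_phi g\<close> and the
  remaining weight vanishes. Only nonnegative values of \<open>f\<close> contribute.\<close>

lemma integral_gauss_odd_nonneg:
  fixes f :: "real \<Rightarrow> real"
  assumes odd: "\<And>x. f (- x) = - f x" and "0 < c" "0 \<le> a"
    and meas: "f \<in> borel_measurable borel"
    and int: "integrable gauss (\<lambda>g. f (a - c * g))"
    and nonneg: "\<And>x. 0 \<le> x \<Longrightarrow> 0 \<le> f x"
  shows "0 \<le> (LINT g|gauss. f (a - c * g))"
proof -
  have "0 \<le> f (a - c * g) * (std_phi g - min (std_phi g) (std_phi (g - 2 * a / c)))" for g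
  proof (cases "c * g \<le> a")
    case False
    then have "\<bar>g - 2 * a / c\<bar> \<le> \<bar>g\<bar>"
      using reflected_point_le[of c a g] \<open>0 < c\<close> \<open>0 \<le> a\<close> by simp
    then show ?thesis
      using std_phi_le_iff[of g "g - 2 * a / c"] by simp
  qed (auto simp: nonneg)
  then show ?thesis
    using assms by (subst integral_gauss_odd) auto
qed

text \<open>This is the convolution of centred normal densities with variances 1 and
  \<open>y^2\<close>, which has variance \<open>1 + y^2\<close>; the substitution
  \<open>u = y * g\<close> brings it to this form.\<close>

lemma integral_gauss_std_phi:
  assumes "0 < y"
  shows "(LINT g|gauss. std_phi (x - y * g)) = std_phi (x / sqrt (1 + y\<^sup>2)) / sqrt (1 + y\<^sup>2)"
proof -
  have norm: "normal_density 0 s t = std_phi (t / s) / s" if "0 < s" for s t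
    using that by (simp add: normal_density_def std_phi_def power_divide real_sqrt_mult)
  have "ennreal (normal_density 0 (sqrt (1\<^sup>2 + y\<^sup>2)) x)
      = (\<integral>\<^sup>+u. ennreal (normal_density 0 1 (x - u) * normal_density 0 y u) \<partial>lborel)"
    using conv_normal_density_zero_mean[of 1 y] assms by (auto simp: fun_eq_iff)
  also have "\<dots> = y * (\<integral>\<^sup>+g. ennreal (normal_density 0 1 (x - y * g) * normal_density 0 y (y * g)) \<partial>lborel)"
    using assms by (subst nn_integral_real_affine[where c=y and t=0]) auto
  also have "\<dots> = (\<integral>\<^sup>+g. ennreal (std_phi (x - y * g) * std_phi g) \<partial>lborel)"
    using assms
    by (subst nn_integral_cmult[symmetric])
       (auto simp: norm ennreal_mult[symmetric] intro!: nn_integral_cong)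
  finally have "(\<integral>\<^sup>+g. ennreal (std_phi (x - y * g) * std_phi g) \<partial>lborel)
      = ennreal (normal_density 0 (sqrt (1\<^sup>2 + y\<^sup>2)) x)" ..
  then have "(LINT g|lborel. std_phi (x - y * g) * std_phi g) = normal_density 0 (sqrt (1\<^sup>2 + y\<^sup>2)) x"
    by (subst integral_eq_nn_integral) auto
  also have "\<dots> = std_phi (x / sqrt (1 + y\<^sup>2)) / sqrt (1 + y\<^sup>2)"
    by (subst norm) (auto intro: add_pos_nonneg)
  finally show ?thesis
    by (simp add: integral_gauss_eq)
qed

lemma std_phi_le_1: "std_phi x \<le> 1"
proof -
  have "std_phi x \<le> std_phi 0" by (simp add: std_phi_le_iff)
  also have "1 \<le> sqrt (2 * pi)" using pi_gt3 by simp
  then have "std_phi 0 \<le> 1" by (simp add: std_phi_def)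
  finally show ?thesis .
qed

text \<open>Both sides have the same derivative in \<open>x\<close>, by the formula for
  \<open>std_phi\<close>, and both vanish at 0 by oddness.\<close>

lemma integral_gauss_std_Psi:
  assumes "0 < y"
  shows "(LINT g|gauss. std_Psi (x - y * g)) = std_Psi (x / sqrt (1 + y\<^sup>2))"
proof -
  let ?r = "sqrt (1 + y\<^sup>2)"
  have r: "0 < ?r" by (auto intro: add_pos_nonneg)
  let ?d = "\<lambda>x. (LINT g|gauss. std_Psi (x - y * g)) - std_Psi (x / ?r)"
  have "((\<lambda>x. LINT g|gauss. std_Psi (x + (- y * g))) has_real_derivative
        (LINT g|gauss. 2 * std_phi (x + (- y * g)))) (at x)" for x
  proof (rule DERIV_integral_translate[where C=2])
    show "\<bar>2 * std_phi x - 2 * std_phi y\<bar> \<le> 2 * \<bar>x - y\<bar>" for x y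
    proof -
      have "\<bar>2 * (std_phi x - std_phi y)\<bar> \<le> 2 * \<bar>x - y\<bar>"
        unfolding abs_mult using std_phi_lipschitz[of x y] by simp
      then show ?thesis by (simp only: right_diff_distrib)
    qed
    show "integrable gauss (\<lambda>g. std_Psi (x + - y * g))" for x
      by (rule integrable_gauss_bounded[where B=1]) (auto simp: abs_std_Psi_le_1)
    show "integrable gauss (\<lambda>g. 2 * std_phi (x + - y * g))" for x
      by (rule integrable_gauss_bounded[where B=2]) (auto simp: std_phi_le_1 abs_mult)
  qed (auto simp: prob_space_gauss DERIV_std_Psi)
  then have 1: "((\<lambda>x. LINT g|gauss. std_Psi (x - y * g)) has_real_derivative
        2 * (std_phi (x / ?r) / ?r)) (at x)" for x
    using integral_gauss_std_phi[OF assms] by simp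
  have 2: "((\<lambda>x. std_Psi (x / ?r)) has_real_derivative 2 * std_phi (x / ?r) * (1 / ?r)) (at x)" for x
    by (rule DERIV_chain2[OF DERIV_std_Psi]) (rule DERIV_cdivide[OF DERIV_ident])
  have "(?d has_real_derivative 0) (at x)" for x
    using DERIV_diff[OF 1 2, of x] by simp
  then have "?d x = ?d 0"
    by (intro DERIV_isconst_all) auto
  also have "(LINT g|gauss. std_Psi (0 - y * g)) = 0"
    using integral_gauss_minus[of "\<lambda>g. std_Psi (y * g)"] by (simp add: std_Psi_minus)
  finally show ?thesis by simp
qed

lemma integral_gauss_sgn:
  assumes "0 < c"
  shows "(LINT g|gauss. sgn (a - c * g)) = std_Psi (a / c)"
proof -
  have "AE g in lborel. g \<noteq> a / c"
    by (rule AE_lborel_singleton)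
  then have "AE g in gauss. g \<noteq> a / c"
    by (simp add: AE_density)
  then have "AE g in gauss. sgn (a - c * g) = 2 * indicator {..a / c} g - 1"
    by eventually_elim (use assms in \<open>auto simp: sgn_if indicator_def field_simps\<close>)
  then have "(LINT g|gauss. sgn (a - c * g)) = (LINT g|gauss. 2 * indicator {..a / c} g - 1)"
    by (intro integral_cong_AE) auto
  also have "\<dots> = std_Psi (a / c)"
    using gauss.prob_space
    by (subst Bochner_Integration.integral_diff)
       (auto simp: std_Psi_def std_Phi_eq_measure intro!: integrable_real_indicator simp: less_top[symmetric])
  finally show ?thesis .
qed

section \<open>The stationary chain\<close>

lemma phi_var_scale:
  assumes "0 < s"
  shows "phi_var (s\<^sup>2) (s * t) = std_phi t / s"
  using assms by (simp add: phi_var_def std_phi_def power_mult_distrib real_sqrt_mult)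

lemma pbar_eq:
  assumes "0 < \<sigma>" "0 < \<gamma>"
  shows "pbar \<sigma> \<gamma> a g = min 1 (std_phi (g - 2 * a / (2 * (\<sigma> * sqrt \<gamma>))) / std_phi g)"
proof -
  define s where "s = \<sigma> * sqrt \<gamma>"
  have s: "0 < s" using assms by (simp add: s_def)
  have *: "\<sigma>\<^sup>2 * \<gamma> = s\<^sup>2" "\<sigma> * sqrt \<gamma> * g = s * g"
    using assms by (auto simp: s_def power_mult_distrib)
  have "a - s * g = s * (- (g - a / s))"
    using s by (simp add: field_simps)
  then have "phi_var (s\<^sup>2) (a - s * g) = std_phi (- (g - a / s)) / s"
    using phi_var_scale[OF s] by metis
  then have "phi_var (s\<^sup>2) (a - s * g) = std_phi (g - a / s) / s"
    by (simp only: std_phi_minus)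
  then show ?thesis
    using s by (simp add: pbar_def * phi_var_scale flip: s_def)
qed

lemma pbar_mult_std_phi:
  assumes "0 < \<sigma>" "0 < \<gamma>"
  shows "pbar \<sigma> \<gamma> a g * std_phi g = min (std_phi g) (std_phi (g - 2 * a / (2 * (\<sigma> * sqrt \<gamma>))))"
  using std_phi_pos[of g] unfolding pbar_eq[OF assms]
  by (simp add: min_mult_distrib_right del: std_phi_pos)

lemma borel_measurable_pbar [measurable]:
  assumes [measurable]: "f \<in> borel_measurable M" "g \<in> borel_measurable M"
  shows "(\<lambda>x. pbar \<sigma> \<gamma> (f x) (g x)) \<in> borel_measurable M"
  unfolding pbar_def phi_var_def by measurable

lemma pbar_bounds:
  assumes "0 < \<sigma>" "0 < \<gamma>"
  shows "0 \<le> pbar \<sigma> \<gamma> a g" "pbar \<sigma> \<gamma> a g \<le> 1"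
  by (auto simp: pbar_eq[OF assms])

locale sticky_chain =
  fixes \<sigma> cinf \<gamma> :: real and \<tau> :: "real \<Rightarrow> real" and \<mu> :: "real measure"
  assumes sigma_pos: "0 < \<sigma>" and cinf_nonneg: "0 \<le> cinf" and gamma_pos: "0 < \<gamma>"
    and tau_mono: "mono_on {0..} \<tau>"
    and tau_nonneg: "\<And>r. 0 \<le> r \<Longrightarrow> 0 \<le> \<tau> r"
    and invariant: "invariant_prob \<sigma> cinf \<gamma> \<tau> \<mu>"
begin

sublocale prob_space \<mu>
  using invariant by (simp add: invariant_prob_def)

lemma sets_mu [measurable_cong, simp]: "sets \<mu> = sets borel"
  using invariant by (simp add: invariant_prob_def)

lemma space_mu [simp]: "space \<mu> = UNIV"
  using sets_eq_imp_space_eq[OF sets_mu] by simp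

lemma AE_nonneg: "AE w in \<mu>. 0 \<le> w"
  by (rule AE_I[of _ _ "{..<0}"]) (use invariant in \<open>auto simp: invariant_prob_def\<close>)

definition s :: real where "s = \<sigma> * sqrt \<gamma>"

lemma s_pos: "0 < s"
  using sigma_pos gamma_pos by (simp add: s_def)

text \<open>Setting the \<open>\<tau>\<close>-part to 0 on the negative half-line, which is
  \<open>\<mu>\<close>-null, makes the function monotone on the whole line and therefore
  Borel.\<close>

definition drift :: "real \<Rightarrow> real" where
  "drift w = (if w < 0 then 0 else \<tau> w) + \<gamma> * cinf"

lemma drift_measurable [measurable]: "drift \<in> borel_measurable borel"
proof (rule borel_measurable_mono, rule monoI)
  fix x y :: real assume "x \<le> y"
  then show "drift x \<le> drift y"
    using tau_nonneg[of y] mono_onD[OF tau_mono, of x y] by (simp add: drift_def)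
qed

abbreviation pb :: "real \<Rightarrow> real \<Rightarrow> real" where
  "pb \<equiv> pbar \<sigma> \<gamma>"

lemmas pb_bounds = pbar_bounds[OF sigma_pos gamma_pos]

text \<open>The transition probability depends on \<open>w\<close> only through the drifted position
  \<open>a\<close>. As a function of \<open>a\<close> it is Borel whatever \<open>\<tau>\<close>
  is.\<close>

definition kernel :: "real \<Rightarrow> real set \<Rightarrow> real" where
  "kernel a A = (LINT g|gauss. indicator A 0 * pb a g + indicator A (a - 2 * s * g) * (1 - pb a g))"

lemma integrable_kernel:
  assumes [measurable]: "A \<in> sets borel"
  shows "integrable gauss (\<lambda>g. indicator A 0 * pb a g + indicator A (a - 2 * s * g) * (1 - pb a g))"
  using pb_bounds[of a]
  by (intro integrable_gauss_bounded[where B=1]) (auto simp: indicator_def)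

lemma kernel_bounds:
  assumes [measurable]: "A \<in> sets borel"
  shows "0 \<le> kernel a A" "kernel a A \<le> 1"
proof -
  show "0 \<le> kernel a A"
    unfolding kernel_def using pb_bounds by (intro Bochner_Integration.integral_nonneg) auto
  have "kernel a A \<le> (LINT g|gauss. 1)"
    unfolding kernel_def using pb_bounds[of a]
    by (intro integral_mono integrable_kernel) (auto simp: indicator_def)
  then show "kernel a A \<le> 1"
    using gauss.prob_space by simp
qed

lemma Qker_eq_kernel:
  assumes [measurable]: "A \<in> sets borel"
  shows "Qker \<sigma> cinf \<gamma> \<tau> w A = kernel (\<tau> w + \<gamma> * cinf) A"
proof -
  let ?a = "\<tau> w + \<gamma> * cinf"
  have 1: "integrable gauss (\<lambda>g. indicator A 0 * pb ?a g)"
    "integrable gauss (\<lambda>g. indicator A (?a - 2 * s * g) * (1 - pb ?a g))"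
    using pb_bounds[of ?a]
    by (auto intro!: integrable_gauss_bounded[where B=1] simp: indicator_def)
  show ?thesis
    unfolding kernel_def using 1
    by (simp add: integral_gauss_eq Qker_def Let_def s_def mult.assoc)
qed

lemma kernel_Compl:
  assumes [measurable]: "A \<in> sets borel"
  shows "kernel a (- A) = 1 - kernel a A"
proof -
  have "(\<lambda>g. (indicator A 0 * pb a g + indicator A (a - 2 * s * g) * (1 - pb a g)) +
      (indicator (- A) 0 * pb a g + indicator (- A) (a - 2 * s * g) * (1 - pb a g))) = (\<lambda>g. 1)"
    by (auto simp: fun_eq_iff indicator_def)
  then have "kernel a A + kernel a (- A) = (LINT g|gauss. 1)"
    unfolding kernel_def
    by (subst Bochner_Integration.integral_add[OF integrable_kernel integrable_kernel, symmetric])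
       simp_all
  then show ?thesis
    using gauss.prob_space by simp
qed

lemma kernel_measurable [measurable]:
  assumes [measurable]: "A \<in> sets borel"
  shows "(\<lambda>a. kernel a A) \<in> borel_measurable borel"
  unfolding kernel_def by measurable

text \<open>Nothing is assumed about \<open>\<tau>\<close> on the negative half-line, so measurability is not automatic. If it
  failed for \<open>A\<close>, it would fail for \<open>- A\<close> too, both Bochner integrals would be \<open>0\<close>, and invariance
  would give \<open>\<mu>\<close> total mass \<open>0\<close>.\<close>

lemma Qker_measurable:
  assumes [measurable]: "A \<in> sets borel"
  shows "(\<lambda>w. Qker \<sigma> cinf \<gamma> \<tau> w A) \<in> borel_measurable \<mu>"
proof (rule ccontr)
  assume *: "(\<lambda>w. Qker \<sigma> cinf \<gamma> \<tau> w A) \<notin> borel_measurable \<mu>"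
  have "Qker \<sigma> cinf \<gamma> \<tau> w A = 1 - Qker \<sigma> cinf \<gamma> \<tau> w (- A)" for w
    using kernel_Compl[of A] by (simp add: Qker_eq_kernel)
  then have **: "(\<lambda>w. Qker \<sigma> cinf \<gamma> \<tau> w (- A)) \<notin> borel_measurable \<mu>"
    using * by (auto simp: fun_eq_iff)
  have "measure \<mu> A = 0" "measure \<mu> (- A) = 0"
  proof -
    have "(\<integral>w. Qker \<sigma> cinf \<gamma> \<tau> w A \<partial>\<mu>) = 0" "(\<integral>w. Qker \<sigma> cinf \<gamma> \<tau> w (- A) \<partial>\<mu>) = 0"
      using * ** borel_measurable_integrable by (blast intro: not_integrable_integral_eq)+
    then show "measure \<mu> A = 0" "measure \<mu> (- A) = 0"
      using invariant by (auto simp: invariant_prob_def)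
  qed
  moreover have "measure \<mu> (- A) = 1 - measure \<mu> A"
    using prob_compl[of A] by (simp add: Compl_eq_Diff_UNIV)
  ultimately show False by simp
qed

lemma measure_eq_kernel:
  assumes [measurable]: "A \<in> sets borel"
  shows "measure \<mu> A = (\<integral>w. kernel (drift w) A \<partial>\<mu>)"
proof -
  have "measure \<mu> A = (\<integral>w. Qker \<sigma> cinf \<gamma> \<tau> w A \<partial>\<mu>)"
    using invariant by (simp add: invariant_prob_def)
  also have "\<dots> = (\<integral>w. kernel (drift w) A \<partial>\<mu>)"
  proof (rule integral_cong_AE)
    show "AE w in \<mu>. Qker \<sigma> cinf \<gamma> \<tau> w A = kernel (drift w) A"
      using AE_nonneg by eventually_elim (auto simp: Qker_eq_kernel drift_def)
  qed (auto intro: Qker_measurable)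
  finally show ?thesis .
qed

section \<open>From invariance on sets to an integral inequality for odd functions\<close>

definition step :: "(real \<Rightarrow> ennreal) \<Rightarrow> real \<Rightarrow> ennreal" where
  "step u a = (\<integral>\<^sup>+g. u 0 * ennreal (pb a g) + u (a - 2 * s * g) * ennreal (1 - pb a g) \<partial>gauss)"

lemma step_measurable [measurable]:
  assumes [measurable]: "u \<in> borel_measurable borel"
  shows "step u \<in> borel_measurable borel"
  unfolding step_def by measurable

lemma step_indicator:
  assumes [measurable]: "A \<in> sets borel"
  shows "step (indicator A) a = ennreal (kernel a A)"
proof -
  have "ennreal (kernel a A) =
    (\<integral>\<^sup>+g. ennreal (indicator A 0 * pb a g + indicator A (a - 2 * s * g) * (1 - pb a g)) \<partial>gauss)"
    unfolding kernel_def using pb_bounds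
    by (intro nn_integral_eq_integral[symmetric] integrable_kernel) auto
  also have "\<dots> = step (indicator A) a"
    unfolding step_def using pb_bounds
    by (intro nn_integral_cong) (auto simp: indicator_def)
  finally show ?thesis ..
qed

text \<open>Invariance is given for sets, which is the case of indicators. Linearity and monotone
  convergence of both sides carry it to every nonnegative Borel function.\<close>

lemma nn_integral_step:
  assumes u: "u \<in> borel_measurable borel"
  shows "(\<integral>\<^sup>+w. u w \<partial>\<mu>) = (\<integral>\<^sup>+w. step u (drift w) \<partial>\<mu>)"
  using u
proof (induction rule: borel_measurable_induct)
  case (cong f g)
  then show ?case by (simp add: fun_eq_iff[symmetric])
next
  case (set A)
  then have [measurable]: "A \<in> sets borel" by simp
  have int: "integrable \<mu> (\<lambda>w. kernel (drift w) A)"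
    using kernel_bounds[of A] by (intro integrable_const_bound[where B=1]) auto
  have "(\<integral>\<^sup>+w. indicator A w \<partial>\<mu>) = ennreal (measure \<mu> A)"
    by (simp add: emeasure_eq_measure)
  also have "\<dots> = (\<integral>\<^sup>+w. ennreal (kernel (drift w) A) \<partial>\<mu>)"
    using kernel_bounds[of A] int
    by (subst measure_eq_kernel) (auto simp: nn_integral_eq_integral)
  finally show ?case
    by (simp add: step_indicator)
next
  case (mult u c)
  have [measurable]: "u \<in> borel_measurable borel"
    by fact
  have "step (\<lambda>x. c * u x) a = c * step u a" for a
    unfolding step_def by (subst nn_integral_cmult[symmetric]) (auto simp: distrib_left mult.assoc)
  then show ?case
    using mult by (simp add: nn_integral_cmult)
next
  case (add u v)
  have [measurable]: "u \<in> borel_measurable borel" "v \<in> borel_measurable borel"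
    by fact+
  have "step (\<lambda>x. v x + u x) a = step v a + step u a" for a
  proof -
    have "step (\<lambda>x. v x + u x) a = (\<integral>\<^sup>+g. (v 0 * ennreal (pb a g) + v (a - 2 * s * g) * ennreal (1 - pb a g))
        + (u 0 * ennreal (pb a g) + u (a - 2 * s * g) * ennreal (1 - pb a g)) \<partial>gauss)"
      unfolding step_def by (simp add: distrib_right add.assoc add.commute add.left_commute)
    also have "\<dots> = step v a + step u a"
      unfolding step_def by (rule nn_integral_add) measurable
    finally show ?thesis .
  qed
  then show ?case
    using add by (simp add: nn_integral_add)
next
  case (seq U)
  have [measurable]: "U i \<in> borel_measurable borel" for i
    by fact
  have "incseq U" by fact
  have IH: "(\<integral>\<^sup>+w. U i w \<partial>\<mu>) = (\<integral>\<^sup>+w. step (U i) (drift w) \<partial>\<mu>)" for i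
    by fact
  have U_mono: "U i x \<le> U j x" if "i \<le> j" for i j x
    using \<open>incseq U\<close> that by (auto dest!: incseqD[where f=U] simp: le_fun_def)
  have integrand_mono: "U i 0 * ennreal (pb a g) + U i (a - 2 * s * g) * ennreal (1 - pb a g)
      \<le> U j 0 * ennreal (pb a g) + U j (a - 2 * s * g) * ennreal (1 - pb a g)" if "i \<le> j" for i j a g
    by (rule add_mono[OF mult_right_mono mult_right_mono]) (use U_mono[OF that] in simp_all)
  have mono: "step (U i) a \<le> step (U j) a" if "i \<le> j" for i j a
    unfolding step_def by (rule nn_integral_mono) (rule integrand_mono[OF that])
  have A: "step (SUP i. U i) a = (SUP i. step (U i) a)" for a
  proof -
    have "step (SUP i. U i) a =
      (\<integral>\<^sup>+g. (SUP i. U i 0 * ennreal (pb a g) + U i (a - 2 * s * g) * ennreal (1 - pb a g)) \<partial>gauss)"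
      unfolding step_def
    proof (intro nn_integral_cong)
      fix g
      have inc: "incseq (\<lambda>i. U i x * r)" for x r
        by (rule incseq_SucI) (simp add: U_mono mult_right_mono)
      show "(SUP i. U i) 0 * ennreal (pb a g) + (SUP i. U i) (a - 2 * s * g) * ennreal (1 - pb a g)
        = (SUP i. U i 0 * ennreal (pb a g) + U i (a - 2 * s * g) * ennreal (1 - pb a g))"
        by (subst ennreal_SUP_add[OF inc inc]) (simp add: SUP_mult_right_ennreal image_comp)
    qed
    also have "\<dots> = (SUP i. step (U i) a)"
      unfolding step_def
    proof (rule nn_integral_monotone_convergence_SUP)
      show "incseq (\<lambda>i g. U i 0 * ennreal (pb a g) + U i (a - 2 * s * g) * ennreal (1 - pb a g))"
        by (rule incseq_SucI) (simp add: le_fun_def integrand_mono)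
    qed measurable
    finally show ?thesis .
  qed
  have B: "(\<integral>\<^sup>+w. (SUP i. U i) w \<partial>\<mu>) = (SUP i. \<integral>\<^sup>+w. U i w \<partial>\<mu>)"
    using nn_integral_monotone_convergence_SUP[OF \<open>incseq U\<close>, of \<mu>] by (simp add: image_comp)
  have C: "(\<integral>\<^sup>+w. (SUP i. step (U i) (drift w)) \<partial>\<mu>) = (SUP i. \<integral>\<^sup>+w. step (U i) (drift w) \<partial>\<mu>)"
    by (rule nn_integral_monotone_convergence_SUP) (auto intro!: incseq_SucI mono simp: le_fun_def)
  show ?case
    unfolding A B C IH ..
qed

text \<open>The shift by \<open>B\<close> makes the function nonnegative, as \<open>step\<close>
  requires. Since \<open>f 0 = 0\<close>, the absorbed mass contributes nothing beyond the shift,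
  and the rest is a plain Gaussian average by \<open>integral_gauss_odd\<close>.\<close>

lemma step_odd:
  fixes f :: "real \<Rightarrow> real"
  assumes [measurable]: "f \<in> borel_measurable borel"
    and odd: "\<And>x. f (- x) = - f x" and bound: "\<And>x. \<bar>f x\<bar> \<le> B"
  shows "step (\<lambda>x. ennreal (f x + B)) a = ennreal ((LINT g|gauss. f (a - 2 * s * g)) + B)"
proof -
  have f0: "f 0 = 0" using odd[of 0] by simp
  have nonneg: "0 \<le> f x + B" for x
    using bound[of x] by linarith
  let ?F = "\<lambda>g. f (a - 2 * s * g) * (1 - pb a g)"
  have intF: "integrable gauss ?F"
  proof (rule integrable_gauss_bounded[where B=B])
    show "\<bar>?F g\<bar> \<le> B" for g
      using pb_bounds[of a g] bound[of "a - 2 * s * g"] mult_mono[of "\<bar>f (a - 2 * s * g)\<bar>" B "1 - pb a g" 1]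
      by (simp add: abs_mult)
  qed measurable
  have "step (\<lambda>x. ennreal (f x + B)) a = (\<integral>\<^sup>+g. ennreal (?F g + B) \<partial>gauss)"
    unfolding step_def
  proof (intro nn_integral_cong)
    fix g
    have "ennreal (f 0 + B) * ennreal (pb a g) + ennreal (f (a - 2 * s * g) + B) * ennreal (1 - pb a g)
      = ennreal ((f 0 + B) * pb a g + (f (a - 2 * s * g) + B) * (1 - pb a g))"
    proof -
      have "ennreal x * ennreal p + ennreal y * ennreal q = ennreal (x * p + y * q)"
        if "0 \<le> x" "0 \<le> y" "0 \<le> p" "0 \<le> q" for x y p q
        using that by (simp add: ennreal_mult)
      then show ?thesis
        using pb_bounds[of a g] nonneg by (metis diff_ge_0_iff_ge)
    qed
    then show "ennreal (f 0 + B) * ennreal (pb a g) + ennreal (f (a - 2 * s * g) + B) * ennreal (1 - pb a g)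
      = ennreal (?F g + B)"
      by (simp add: f0 algebra_simps)
  qed
  also have "\<dots> = ennreal (LINT g|gauss. ?F g + B)"
  proof (rule nn_integral_eq_integral)
    show "AE g in gauss. 0 \<le> ?F g + B"
    proof (rule AE_I2)
      fix g
      have "0 \<le> (f 0 + B) * pb a g + (f (a - 2 * s * g) + B) * (1 - pb a g)"
        using pb_bounds[of a g] nonneg[of 0] nonneg[of "a - 2 * s * g"]
        by (intro add_nonneg_nonneg[OF mult_nonneg_nonneg mult_nonneg_nonneg]) auto
      then show "0 \<le> ?F g + B" by (simp add: f0 algebra_simps)
    qed
  qed (use intF in auto)
  also have "(LINT g|gauss. ?F g + B) = (LINT g|gauss. ?F g) + B"
    using intF gauss.prob_space by simp
  also have "(LINT g|gauss. ?F g) =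
      (LINT g|lborel. f (a - 2 * s * g) * (std_phi g - min (std_phi g) (std_phi (g - 2 * a / (2 * s)))))"
    using pbar_mult_std_phi[OF sigma_pos gamma_pos, of a]
    by (subst integral_gauss_eq) (auto simp: s_def algebra_simps intro!: Bochner_Integration.integral_cong)
  also have "\<dots> = (LINT g|gauss. f (a - 2 * s * g))"
    using s_pos odd bound
    by (intro integral_gauss_odd[symmetric] integrable_gauss_bounded[where B=B]) auto
  finally show ?thesis .
qed

text \<open>All later estimates use the stationarity equation through this inequality. The majorant
  \<open>h\<close> is only required to be integrable, because it will contain a multiple of
  \<open>w\<close>.\<close>

lemma stationary_odd:
  fixes f h :: "real \<Rightarrow> real"
  assumes meas [measurable]: "f \<in> borel_measurable borel"
    and odd: "\<And>x. f (- x) = - f x" and bound: "\<And>x. \<bar>f x\<bar> \<le> B"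
    and h: "integrable \<mu> h"
    and le: "\<And>w. 0 \<le> w \<Longrightarrow> (LINT g|gauss. f (\<tau> w + \<gamma> * cinf - 2 * s * g)) \<le> h w"
  shows "(\<integral>w. f w \<partial>\<mu>) \<le> (\<integral>w. h w \<partial>\<mu>)"
proof -
  let ?E = "\<lambda>a. LINT g|gauss. f (a - 2 * s * g)"
  have [measurable]: "?E \<in> borel_measurable borel"
    by measurable
  have E_bound: "\<bar>?E a\<bar> \<le> B" for a
  proof -
    have "0 \<le> B" using bound[of 0] by linarith
    have "\<bar>?E a\<bar> \<le> (LINT g|gauss. \<bar>f (a - 2 * s * g)\<bar>)"
      by (rule integral_abs_bound)
    also have "\<dots> \<le> (LINT g|gauss. B)"
      using bound \<open>0 \<le> B\<close> by (intro integral_mono integrable_abs integrable_gauss_bounded[where B=B]) auto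
    finally show ?thesis using gauss.prob_space by simp
  qed
  have int: "integrable \<mu> f" "integrable \<mu> (\<lambda>w. ?E (drift w))"
    using bound E_bound by (auto intro!: integrable_const_bound[where B=B])
  have nonneg: "0 \<le> f w + B" "0 \<le> ?E a + B" for w a
    using bound[of w] E_bound[of a] by linarith+
  have "ennreal (\<integral>w. f w + B \<partial>\<mu>) = (\<integral>\<^sup>+w. ennreal (f w + B) \<partial>\<mu>)"
    using int nonneg by (intro nn_integral_eq_integral[symmetric]) auto
  also have "\<dots> = (\<integral>\<^sup>+w. ennreal (?E (drift w) + B) \<partial>\<mu>)"
    using step_odd[OF meas odd bound] by (subst nn_integral_step) auto
  also have "\<dots> = ennreal (\<integral>w. ?E (drift w) + B \<partial>\<mu>)"
    using int nonneg by (intro nn_integral_eq_integral) auto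
  finally have "(\<integral>w. f w + B \<partial>\<mu>) = (\<integral>w. ?E (drift w) + B \<partial>\<mu>)"
    using nonneg by (subst (asm) ennreal_inj) (auto intro!: Bochner_Integration.integral_nonneg)
  then have "(\<integral>w. f w \<partial>\<mu>) = (\<integral>w. ?E (drift w) \<partial>\<mu>)"
    using int prob_space by simp
  also have "\<dots> \<le> (\<integral>w. h w \<partial>\<mu>)"
  proof (rule integral_mono_AE[OF int(2) h])
    show "AE w in \<mu>. ?E (drift w) \<le> h w"
      using AE_nonneg by eventually_elim (use le in \<open>auto simp: drift_def\<close>)
  qed
  finally show ?thesis .
qed

end

section \<open>First moment and the mass near the origin\<close>

lemma std_phi_0: "std_phi 0 = 1 / sqrt (2 * pi)"
  by (simp add: std_phi_def)

lemma integrable_gauss_power [simp]: "integrable gauss (\<lambda>g. g ^ k)"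
  using integrable_std_normal_moment[of k]
  by (subst integrable_gauss_iff) (auto simp: std_phi_eq_normal_density mult.commute)

lemma integrable_gauss_id [simp]: "integrable gauss (\<lambda>g. g)"
  using integrable_gauss_power[of 1] by simp

lemma integral_gauss_id [simp]: "(LINT g|gauss. g) = 0"
  using integral_std_normal_moment_odd[of 0]
  by (subst integral_gauss_eq) (auto simp: std_phi_eq_normal_density mult.commute)

text \<open>The quotient bounds are written in product form. At \<open>r = 0\<close>,
  \<open>tau_L\<close> together with nonnegativity encodes \<open>\<tau> 0 = 0\<close>.\<close>

locale sticky_chain_bound = sticky_chain +
  fixes R1 L m :: real
  assumes R1_nonneg: "0 \<le> R1" and L_nonneg: "0 \<le> L" and m_pos: "0 < m"
    and tau_L: "\<And>r. 0 \<le> r \<Longrightarrow> \<tau> r \<le> (1 + \<gamma> * L) * r"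
    and tau_m: "\<And>r. R1 < r \<Longrightarrow> \<tau> r \<le> (1 - \<gamma> * m) * r"
begin

text \<open>The first moment is not yet known to be finite, so the identity is truncated at
  \<open>M\<close>. The bound by \<open>a\<close> holds because the identity minus its truncation is
  odd and nonnegative on the half-line, while the identity averages to \<open>a\<close>.\<close>

lemma integral_gauss_clip_le:
  fixes a M :: real
  assumes "0 \<le> a" "0 \<le> M"
  shows "(LINT g|gauss. max (- M) (min M (a - 2 * s * g))) \<le> min a M"
proof -
  let ?c = "\<lambda>x::real. max (- M) (min M x)"
  have int_c: "integrable gauss (\<lambda>g. ?c (a - 2 * s * g))"
    using assms by (intro integrable_gauss_bounded[where B=M]) (auto simp: abs_le_iff)
  have int_id: "integrable gauss (\<lambda>g. a - 2 * s * g)"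
    by simp
  have "(LINT g|gauss. ?c (a - 2 * s * g)) \<le> (LINT g|gauss. M)"
    using assms by (intro integral_mono int_c) auto
  then have 1: "(LINT g|gauss. ?c (a - 2 * s * g)) \<le> M"
    using gauss.prob_space by simp
  have "0 \<le> (LINT g|gauss. (\<lambda>x. x - ?c x) (a - 2 * s * g))"
    using s_pos assms int_c int_id
    by (intro integral_gauss_odd_nonneg Bochner_Integration.integrable_diff)
       (auto simp: max_def min_def)
  also have "\<dots> = (LINT g|gauss. a - 2 * s * g) - (LINT g|gauss. ?c (a - 2 * s * g))"
    using int_c int_id by (rule Bochner_Integration.integral_diff[rotated])
  also have "(LINT g|gauss. a - 2 * s * g) = a"
    using gauss.prob_space by simp
  finally show ?thesis using 1 by simp
qed

lemma truncated_moment_le: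
  assumes "0 \<le> M"
  shows "m * (\<integral>w. indicator {0..M} w * w \<partial>\<mu>) \<le> cinf + (L + m) * R1 * measure \<mu> {0<..R1}"
proof -
  \<comment> \<open>This is the largest excess of \<open>(1 + \<gamma> * L) * w\<close> over
    \<open>(1 - \<gamma> * m) * w\<close> for \<open>w\<close> in \<open>(0, R1]\<close>, where
    contraction is not assumed.\<close>
  define K where "K = \<gamma> * (L + m) * R1"
  define B where "B = \<bar>1 - \<gamma> * m\<bar> * M"
  have nonneg: "0 \<le> K" "0 \<le> \<gamma> * cinf" "0 \<le> B"
    using gamma_pos L_nonneg m_pos R1_nonneg cinf_nonneg assms by (auto simp: K_def B_def)
  let ?clip = "\<lambda>x::real. max (- M) (min M x)"
  \<comment> \<open>Above \<open>M\<close> the trivial bound \<open>M\<close> is used. It cancels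
    against the truncated function there, so only \<open>w \<le> M\<close> contributes to the
    balance.\<close>
  define h :: "real \<Rightarrow> real" where "h w = (if w \<in> {0..M} then (1 - \<gamma> * m) * w + K * indicator {0<..R1} w + \<gamma> * cinf else M)" for w
  have [measurable]: "h \<in> borel_measurable borel"
    unfolding h_def by measurable
  have h_bound: "\<bar>h w\<bar> \<le> B + K + \<gamma> * cinf + M" for w
  proof -
    have "\<bar>(1 - \<gamma> * m) * w\<bar> \<le> B" if "w \<in> {0..M}"
      using that by (auto simp: B_def abs_mult intro!: mult_left_mono)
    then show ?thesis
      using assms nonneg unfolding h_def indicator_def by (auto simp: abs_le_iff)
  qed
  have int_h: "integrable \<mu> h"
    by (rule integrable_const_bound[of _ "B + K + \<gamma> * cinf + M"]) (use h_bound in auto)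
  have int_c: "integrable \<mu> ?clip"
    using assms by (intro integrable_const_bound[where B=M]) (auto simp: abs_le_iff)
  have "(\<integral>w. ?clip w \<partial>\<mu>) \<le> (\<integral>w. h w \<partial>\<mu>)"
  proof (rule stationary_odd[where B=M, OF _ _ _ int_h])
    fix w :: real assume w: "0 \<le> w"
    let ?a = "\<tau> w + \<gamma> * cinf"
    have "0 \<le> ?a"
      using tau_nonneg[OF w] gamma_pos cinf_nonneg by simp
    then have E: "(LINT g|gauss. ?clip (?a - 2 * s * g)) \<le> min ?a M"
      using integral_gauss_clip_le assms by blast
    have "\<tau> w \<le> (1 - \<gamma> * m) * w + K * indicator {0<..R1} w"
    proof (cases "w \<in> {0<..R1}")
      case True
      then have "\<gamma> * (L + m) * w \<le> K"
        using gamma_pos L_nonneg m_pos unfolding K_def by (intro mult_left_mono) auto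
      then show ?thesis
        using tau_L[OF w] True by (simp add: algebra_simps)
    next
      case False
      then have "w = 0 \<or> R1 < w" using w by auto
      then show ?thesis
        using tau_L[of 0] tau_m[of w] False by auto
    qed
    then show "(LINT g|gauss. ?clip (?a - 2 * s * g)) \<le> h w"
      using E w by (auto simp: h_def)
  qed (use assms in \<open>auto simp: max_def min_def abs_le_iff\<close>)
  then have "0 \<ge> (\<integral>w. ?clip w - h w \<partial>\<mu>)"
    using int_h int_c by simp
  also have "(\<integral>w. ?clip w - h w \<partial>\<mu>) \<ge>
    (\<integral>w. \<gamma> * m * (indicator {0..M} w * w) - K * indicator {0<..R1} w - \<gamma> * cinf \<partial>\<mu>)" (is "_ \<ge> ?I")
  proof (rule integral_mono_AE)
    show "AE w in \<mu>. \<gamma> * m * (indicator {0..M} w * w) - K * indicator {0<..R1} w - \<gamma> * cinf \<le> ?clip w - h w"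
      using AE_nonneg
    proof eventually_elim
      case (elim w)
      have "0 \<le> K * indicator {0<..R1} w"
        using nonneg by auto
      show ?case
      proof (cases "w \<le> M")
        case False
        then have "h w = M" "max (- M) (min M w) = M" "indicator {0..M} w = (0 :: real)"
          using assms by (auto simp: h_def)
        then show ?thesis
          using \<open>0 \<le> K * indicator {0<..R1} w\<close> nonneg(2) by simp
      qed (use elim assms nonneg in \<open>auto simp: h_def algebra_simps\<close>)
    qed
    have "integrable \<mu> (\<lambda>w. indicator {0..M} w * w)"
      using assms by (intro integrable_const_bound[where B=M]) (auto simp: indicator_def)
    moreover have "integrable \<mu> (\<lambda>w. indicator {0<..R1} w :: real)"
      by (intro integrable_real_indicator) (auto simp: less_top[symmetric])
    ultimately show "integrable \<mu> (\<lambda>w. \<gamma> * m * (indicator {0..M} w * w) - K * indicator {0<..R1} w - \<gamma> * cinf)"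
      by (intro Bochner_Integration.integrable_diff integrable_mult_right) auto
  qed (use int_h int_c in auto)
  also have "?I = \<gamma> * m * (\<integral>w. indicator {0..M} w * w \<partial>\<mu>) - K * measure \<mu> {0<..R1} - \<gamma> * cinf"
  proof -
    have 1: "integrable \<mu> (\<lambda>w. indicator {0..M} w * w)"
      using assms by (intro integrable_const_bound[where B=M]) (auto simp: indicator_def)
    have 2: "integrable \<mu> (\<lambda>w. indicator {0<..R1} w :: real)"
      by (intro integrable_real_indicator) (auto simp: less_top[symmetric])
    show ?thesis
      using 1 2 prob_space by simp
  qed
  finally have "\<gamma> * (m * (\<integral>w. indicator {0..M} w * w \<partial>\<mu>)) \<le> \<gamma> * (cinf + (L + m) * R1 * measure \<mu> {0<..R1})"
    by (simp add: K_def algebra_simps)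
  then show ?thesis
    using gamma_pos by (simp add: mult_le_cancel_left)
qed

text \<open>The truncated bound does not depend on \<open>M\<close>, so monotone convergence removes
  the truncation. Integrability of the identity follows from this.\<close>

lemma first_moment_le:
  "(\<integral>\<^sup>+w. ennreal w \<partial>\<mu>) \<le> ennreal ((cinf + (L + m) * R1 * measure \<mu> {0<..R1}) / m)"
    (is "_ \<le> ennreal ?K")
proof -
  have "(\<integral>\<^sup>+w. ennreal w \<partial>\<mu>) = (\<integral>\<^sup>+w. (SUP n::nat. ennreal (indicator {0..real n} w * w)) \<partial>\<mu>)"
  proof (rule nn_integral_cong)
    fix w :: real
    show "ennreal w = (SUP n::nat. ennreal (indicator {0..real n} w * w))"
    proof (rule antisym)
      obtain n :: nat where "w \<le> real n"
        using real_arch_simple by blast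
      then have "ennreal w \<le> ennreal (indicator {0..real n} w * w)"
        by (cases "0 \<le> w") (auto simp: ennreal_neg)
      then show "ennreal w \<le> (SUP n::nat. ennreal (indicator {0..real n} w * w))"
        by (rule SUP_upper2[OF UNIV_I])
      show "(SUP n::nat. ennreal (indicator {0..real n} w * w)) \<le> ennreal w"
        by (rule SUP_least) (auto simp: indicator_def)
    qed
  qed
  also have "\<dots> = (SUP n::nat. \<integral>\<^sup>+w. ennreal (indicator {0..real n} w * w) \<partial>\<mu>)"
    by (rule nn_integral_monotone_convergence_SUP)
       (auto intro!: incseq_SucI le_funI ennreal_leI simp: indicator_def)
  also have "\<dots> \<le> ennreal ?K"
  proof (rule SUP_least)
    fix n :: nat
    have int: "integrable \<mu> (\<lambda>w. indicator {0..real n} w * w)"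
      by (intro integrable_const_bound[where B="real n"]) (auto simp: indicator_def)
    have "(\<integral>\<^sup>+w. ennreal (indicator {0..real n} w * w) \<partial>\<mu>) = ennreal (\<integral>w. indicator {0..real n} w * w \<partial>\<mu>)"
      by (rule nn_integral_eq_integral[OF int]) (auto simp: indicator_def)
    also have "\<dots> \<le> ennreal ?K"
      using truncated_moment_le[of "real n"] m_pos
      by (intro ennreal_leI) (simp add: pos_le_divide_eq mult.commute)
    finally show "(\<integral>\<^sup>+w. ennreal (indicator {0..real n} w * w) \<partial>\<mu>) \<le> ennreal ?K" .
  qed
  finally show ?thesis .
qed

lemma integrable_id: "integrable \<mu> (\<lambda>w. w)"
proof (rule integrableI_bounded)
  have "(\<integral>\<^sup>+w. ennreal (norm w) \<partial>\<mu>) = (\<integral>\<^sup>+w. ennreal w \<partial>\<mu>)"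
    using AE_nonneg by (intro nn_integral_cong_AE) auto
  also have "\<dots> < \<infinity>"
    using first_moment_le by (rule le_less_trans) simp
  finally show "(\<integral>\<^sup>+w. ennreal (norm w) \<partial>\<mu>) < \<infinity>" .
qed simp

section \<open>Iterated comparison starting from \<open>sgn\<close>, and the mass of
  \<open>(0, R1]\<close>\<close>

definition \<alpha> :: real where "\<alpha> = 1 + \<gamma> * L"

lemma alpha_ge_1: "1 \<le> \<alpha>"
  using gamma_pos L_nonneg by (simp add: \<alpha>_def)

text \<open>Up to the drift \<open>cinf\<close>, \<open>survival n w\<close> bounds the probability that the chain started
  at \<open>w\<close> is positive after \<open>n\<close> steps.\<close>

definition survival :: "nat \<Rightarrow> real \<Rightarrow> real" where
  "survival n w = (if n = 0 then sgn w else std_Psi (\<alpha> ^ n * w / (2 * s * sqrt n)))"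

lemma survival_measurable [measurable]: "survival n \<in> borel_measurable borel"
  unfolding survival_def by (cases "n = 0") simp_all

lemma survival_minus: "survival n (- w) = - survival n w"
  using std_Psi_minus[of "\<alpha> ^ n * w / (2 * s * sqrt n)"] by (simp add: survival_def sgn_minus)

lemma abs_survival_le_1: "\<bar>survival n w\<bar> \<le> 1"
  using abs_std_Psi_le_1 by (auto simp: survival_def abs_sgn_eq)

lemma integrable_survival: "integrable \<mu> (survival n)"
  by (rule integrable_const_bound[of _ 1]) (use abs_survival_le_1 in auto)

text \<open>Averaging replaces \<open>sqrt n\<close> by \<open>sqrt (n + (\<alpha> ^ n)^2)\<close>,
  which is at least \<open>sqrt (Suc n)\<close> because \<open>\<alpha> \<ge> 1\<close>. As
  \<open>a \<ge> 0\<close>, the smaller denominator increases the argument of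
  \<open>std_Psi\<close>.\<close>

lemma integral_gauss_survival_le:
  assumes "0 \<le> a"
  shows "(LINT g|gauss. survival n (a - 2 * s * g)) \<le> std_Psi (\<alpha> ^ n * a / (2 * s * sqrt (Suc n)))"
proof (cases "n = 0")
  case True
  then show ?thesis
    using integral_gauss_sgn[of "2 * s" a] s_pos by (simp add: survival_def mult.assoc)
next
  case False
  let ?A = "\<alpha> ^ n" and ?y = "\<alpha> ^ n / sqrt n"
  have A: "1 \<le> ?A" using alpha_ge_1 by simp
  have y: "0 < ?y" using A False by (intro divide_pos_pos) auto
  have "\<alpha> ^ n * (a - 2 * s * g) / (2 * s * sqrt n) = \<alpha> ^ n * a / (2 * s * sqrt n) - ?y * g" for g
    using s_pos False by (simp add: field_simps)
  then have "(LINT g|gauss. survival n (a - 2 * s * g)) = std_Psi (?A * a / (2 * s * sqrt n) / sqrt (1 + ?y\<^sup>2))"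
    using integral_gauss_std_Psi[OF y] False by (simp add: survival_def)
  also have "\<dots> \<le> std_Psi (?A * a / (2 * s * sqrt (Suc n)))"
  proof (rule std_Psi_mono)
    have "sqrt n * sqrt (1 + ?y\<^sup>2) = sqrt (n + ?A\<^sup>2)"
      unfolding real_sqrt_mult[symmetric] using False by (simp add: power_divide field_simps)
    also have "sqrt (Suc n) \<le> sqrt (n + ?A\<^sup>2)"
      using A by simp
    finally have le: "sqrt (Suc n) \<le> sqrt n * sqrt (1 + ?y\<^sup>2)" .
    then have "0 < sqrt n * sqrt (1 + ?y\<^sup>2)"
      by (rule less_le_trans[rotated]) simp
    with le have "?A * a / (2 * s * (sqrt n * sqrt (1 + ?y\<^sup>2))) \<le> ?A * a / (2 * s * sqrt (Suc n))"
      using A assms s_pos by (intro frac_le mult_left_mono) auto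
    then show "?A * a / (2 * s * sqrt n) / sqrt (1 + ?y\<^sup>2) \<le> ?A * a / (2 * s * sqrt (Suc n))"
      by (simp add: mult.assoc)
  qed
  finally show ?thesis .
qed

text \<open>Bounding \<open>\<tau> w\<close> by \<open>\<alpha> * w\<close> produces
  \<open>survival (Suc n)\<close>. The remaining shift by \<open>\<gamma> * cinf\<close> costs at
  most its rescaled size times the slope \<open>2 * std_phi 0\<close> of \<open>std_Psi\<close> at
  0.\<close>

lemma integral_survival_le:
  "(\<integral>w. survival n w \<partial>\<mu>) \<le>
    (\<integral>w. survival (Suc n) w \<partial>\<mu>) + std_phi 0 * \<gamma> * cinf / s * (\<alpha> ^ n / sqrt (Suc n))"
proof -
  let ?e = "std_phi 0 * \<gamma> * cinf / s * (\<alpha> ^ n / sqrt (Suc n))"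
  have "(\<integral>w. survival n w \<partial>\<mu>) \<le> (\<integral>w. survival (Suc n) w + ?e \<partial>\<mu>)"
  proof (rule stationary_odd[where B=1])
    fix w :: real assume w: "0 \<le> w"
    let ?a = "\<tau> w + \<gamma> * cinf" and ?r = "2 * s * sqrt (Suc n)"
    have a: "0 \<le> ?a" "?a \<le> \<alpha> * w + \<gamma> * cinf"
      using w tau_nonneg tau_L gamma_pos cinf_nonneg by (auto simp: \<alpha>_def)
    have r: "0 < ?r" using s_pos by simp
    have An: "1 \<le> \<alpha> ^ n" using alpha_ge_1 by simp
    have "(LINT g|gauss. survival n (?a - 2 * s * g)) \<le> std_Psi (\<alpha> ^ n * ?a / ?r)"
      by (rule integral_gauss_survival_le[OF a(1)])
    also have "\<dots> \<le> std_Psi (\<alpha> ^ Suc n * w / ?r + \<alpha> ^ n * (\<gamma> * cinf) / ?r)"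
    proof (rule std_Psi_mono)
      have "\<alpha> ^ n * ?a / ?r \<le> \<alpha> ^ n * (\<alpha> * w + \<gamma> * cinf) / ?r"
        using a(2) An r by (intro divide_right_mono mult_left_mono) auto
      then show "\<alpha> ^ n * ?a / ?r \<le> \<alpha> ^ Suc n * w / ?r + \<alpha> ^ n * (\<gamma> * cinf) / ?r"
        by (simp add: distrib_left add_divide_distrib mult_ac)
    qed
    also have "\<dots> \<le> std_Psi (\<alpha> ^ Suc n * w / ?r) + \<alpha> ^ n * (\<gamma> * cinf) / ?r * (2 * std_phi 0)"
      using w r alpha_ge_1 gamma_pos cinf_nonneg
      by (intro std_Psi_increment_le divide_nonneg_pos mult_nonneg_nonneg zero_le_power) auto
    also have "\<dots> = survival (Suc n) w + ?e"
      using s_pos by (simp add: survival_def field_simps)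
    finally show "(LINT g|gauss. survival n (?a - 2 * s * g)) \<le> survival (Suc n) w + ?e" .
  qed (use survival_minus abs_survival_le_1 integrable_survival in auto)
  then show ?thesis
    using integrable_survival[of "Suc n"] prob_space by simp
qed

lemma integral_survival_0_le:
  "(\<integral>w. survival 0 w \<partial>\<mu>) \<le>
    (\<integral>w. survival n w \<partial>\<mu>) + std_phi 0 * \<gamma> * cinf / s * (\<alpha> ^ n * (2 * sqrt n))"
proof (induction n)
  case (Suc n)
  let ?k = "std_phi 0 * \<gamma> * cinf / s"
  have k: "0 \<le> ?k" using gamma_pos cinf_nonneg s_pos by simp
  have An: "1 \<le> \<alpha> ^ n" using alpha_ge_1 by simp
  \<comment> \<open>Expanding the square of \<open>sqrt (Suc n) - sqrt n\<close> gives this; it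
    makes the sum of the step costs telescope to \<open>2 * sqrt n\<close>.\<close>
  have "1 / sqrt (Suc n) \<le> 2 * (sqrt (Suc n) - sqrt n)"
  proof -
    have "sqrt (real (Suc n)) * sqrt (Suc n) = Suc n" "sqrt (real n) * sqrt n = n" by simp_all
    moreover have "0 \<le> (sqrt (Suc n) - sqrt n) * (sqrt (Suc n) - sqrt n)" by simp
    ultimately have "1 \<le> 2 * (sqrt (Suc n) - sqrt n) * sqrt (Suc n)"
      by (simp add: algebra_simps del: real_sqrt_mult_self)
    then show ?thesis by (simp add: pos_divide_le_eq)
  qed
  then have "\<alpha> ^ n * (1 / sqrt (Suc n)) \<le> \<alpha> ^ n * (2 * (sqrt (Suc n) - sqrt n))"
    using An by (intro mult_left_mono) auto
  then have "\<alpha> ^ n * (2 * sqrt n) + \<alpha> ^ n / sqrt (Suc n) \<le> \<alpha> ^ n * (2 * sqrt (Suc n))"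
    by (simp add: algebra_simps)
  also have "\<dots> \<le> \<alpha> ^ Suc n * (2 * sqrt (Suc n))"
    using An alpha_ge_1 by (intro mult_right_mono power_increasing) auto
  finally have "?k * (\<alpha> ^ n * (2 * sqrt n) + \<alpha> ^ n / sqrt (Suc n)) \<le> ?k * (\<alpha> ^ Suc n * (2 * sqrt (Suc n)))"
    using k by (rule mult_left_mono)
  then show ?case
    using Suc.IH integral_survival_le[of n] by (simp only: distrib_left)
qed simp

lemma survival_le_0: "0 \<le> w \<Longrightarrow> survival n w \<le> survival 0 w"
  using std_Psi_le_1 by (cases "w = 0") (auto simp: survival_def sgn_if)

text \<open>The difference \<open>survival 0 - survival n\<close> is nonnegative on the half-line
  and its integral is at most the accumulated cost. On \<open>(0, R1]\<close> it is at least its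
  value at \<open>R1\<close>, because \<open>1 - std_Psi x = 2 * std_Phi (- x)\<close>.\<close>

lemma measure_near_0_le:
  assumes "0 < n"
  shows "std_Phi (- (\<alpha> ^ n * R1 / (2 * s * sqrt n))) * measure \<mu> {0<..R1}
    \<le> std_phi 0 * \<gamma> * cinf / s * (\<alpha> ^ n * sqrt n)"
proof -
  let ?P = "std_Phi (- (\<alpha> ^ n * R1 / (2 * s * sqrt n)))"
  have "2 * ?P * measure \<mu> {0<..R1} = (\<integral>w. 2 * ?P * indicator {0<..R1} w \<partial>\<mu>)"
    by simp
  also have "\<dots> \<le> (\<integral>w. survival 0 w - survival n w \<partial>\<mu>)"
  proof (rule integral_mono_AE)
    show "AE w in \<mu>. 2 * ?P * indicator {0<..R1} w \<le> survival 0 w - survival n w"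
      using AE_nonneg
    proof eventually_elim
      case (elim w)
      show ?case
      proof (cases "w \<in> {0<..R1}")
        case True
        have "survival n w \<le> std_Psi (\<alpha> ^ n * R1 / (2 * s * sqrt n))"
          using True assms s_pos alpha_ge_1
          by (auto simp: survival_def intro!: std_Psi_mono divide_right_mono mult_left_mono)
        also have "\<dots> = 1 - 2 * ?P"
          unfolding std_Phi_minus by (simp add: std_Psi_def)
        finally show ?thesis
          using True by (simp add: survival_def)
      qed (use survival_le_0[OF elim, of n] in simp)
    qed
    show "integrable \<mu> (\<lambda>w. 2 * ?P * indicator {0<..R1} w)"
      by (intro integrable_mult_right integrable_real_indicator) (auto simp: less_top[symmetric])
  qed (use integrable_survival in auto)
  also have "\<dots> \<le> 2 * (std_phi 0 * \<gamma> * cinf / s * (\<alpha> ^ n * sqrt n))"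
    using integral_survival_0_le[of n] integrable_survival by (simp add: mult_ac)
  finally show ?thesis by linarith
qed

lemma integral_survival_0: "(\<integral>w. survival 0 w \<partial>\<mu>) = measure \<mu> {0<..}"
proof -
  have "(\<integral>w. survival 0 w \<partial>\<mu>) = (\<integral>w. indicator {0<..} w \<partial>\<mu>)"
    using AE_nonneg by (intro integral_cong_AE) (auto simp: survival_def sgn_if indicator_def)
  then show ?thesis by simp
qed

text \<open>One step from \<open>sgn\<close>, after which \<open>survival 1\<close> is bounded by
  its tangent at 0, a multiple of \<open>w\<close>.\<close>

lemma measure_pos_le_one_step:
  "measure \<mu> {0<..} \<le> std_phi 0 / s * (\<alpha> * (\<integral>w. w \<partial>\<mu>) + \<gamma> * cinf)"
proof -
  have "(\<integral>w. survival 1 w \<partial>\<mu>) \<le> (\<integral>w. std_phi 0 / s * \<alpha> * w \<partial>\<mu>)"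
  proof (rule integral_mono_AE)
    show "AE w in \<mu>. survival 1 w \<le> std_phi 0 / s * \<alpha> * w"
      using AE_nonneg
    proof eventually_elim
      case (elim w)
      then have "0 \<le> \<alpha> * w / (2 * s)"
        using alpha_ge_1 s_pos by simp
      then show ?case
        using std_Psi_increment_le[of 0 "\<alpha> * w / (2 * s)"] by (simp add: survival_def field_simps)
    qed
  qed (use integrable_survival integrable_id in auto)
  then show ?thesis
    using integral_survival_le[of 0] unfolding integral_survival_0
    by (simp add: algebra_simps)
qed

end

section \<open>The cubic test function\<close>

lemma integral_gauss_square [simp]: "(LINT g|gauss. g\<^sup>2) = 1"
  using integral_std_normal_moment_even[of 1]
  by (subst integral_gauss_eq) (auto simp: std_phi_eq_normal_density mult.commute)

lemma integral_gauss_cube [simp]: "(LINT g|gauss. g ^ 3) = 0"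
  using integral_std_normal_moment_odd[of 1]
  by (subst integral_gauss_eq) (auto simp: std_phi_eq_normal_density mult.commute eval_nat_numeral)

lemma integrable_gauss_abs [simp]: "integrable gauss (\<lambda>g. \<bar>g\<bar>)"
  by (rule integrable_abs) simp

lemma integral_gauss_abs: "(LINT g|gauss. \<bar>g\<bar>) = 2 * std_phi 0"
proof -
  have "(LINT g|gauss. \<bar>g\<bar>) = sqrt (2 / pi)"
    using integral_std_normal_moment_abs_odd[of 0]
    by (subst integral_gauss_eq) (auto simp: std_phi_eq_normal_density mult.commute)
  also have "\<dots> = 2 * std_phi 0"
    by (simp add: std_phi_0 real_sqrt_divide real_sqrt_mult field_simps)
  finally show ?thesis .
qed

lemma tendsto_linear_std_phi: "((\<lambda>g. (x - g) * std_phi g) \<longlongrightarrow> 0) at_top"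
proof (rule Lim_null_comparison)
  have "norm ((x - g) * std_phi g) \<le> (\<bar>x\<bar> + 1) * 2 / g" if "1 \<le> g" for g
  proof -
    have "g\<^sup>2 / 2 \<le> exp (g\<^sup>2 / 2)"
      using exp_ge_add_one_self[of "g\<^sup>2 / 2"] by linarith
    then have "exp (- (g\<^sup>2 / 2)) \<le> 2 / g\<^sup>2"
      using that by (simp add: exp_minus field_simps)
    moreover have "1 \<le> sqrt (2 * pi)" using pi_gt3 by simp
    then have "std_phi g \<le> exp (- (g\<^sup>2 / 2))"
      by (simp add: std_phi_def divide_le_eq mult_le_cancel_left1)
    ultimately have "std_phi g \<le> 2 / g\<^sup>2" by linarith
    moreover have "\<bar>x - g\<bar> \<le> (\<bar>x\<bar> + 1) * g"
      using that mult_left_mono[of 1 g "\<bar>x\<bar>"] by (simp add: algebra_simps)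
    ultimately have "\<bar>x - g\<bar> * std_phi g \<le> (\<bar>x\<bar> + 1) * g * (2 / g\<^sup>2)"
      using that by (intro mult_mono) auto
    also have "\<dots> = (\<bar>x\<bar> + 1) * 2 / g"
      using that by (simp add: power2_eq_square)
    finally show ?thesis by (simp add: abs_mult)
  qed
  then show "eventually (\<lambda>g. norm ((x - g) * std_phi g) \<le> (\<bar>x\<bar> + 1) * 2 / g) at_top"
    by (auto simp: eventually_at_top_linorder)
  show "((\<lambda>g. (\<bar>x\<bar> + 1) * 2 / g) \<longlongrightarrow> 0) at_top"
    by (rule tendsto_divide_0[OF tendsto_const filterlim_at_top_imp_at_infinity[OF filterlim_ident]])
qed

text \<open>The integrand has the antiderivative \<open>(x - g) * std_phi g\<close>, which vanishes
  at \<open>x\<close> and at infinity.\<close>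

lemma integral_gauss_tail_eq_0:
  "(LINT g|gauss. indicator {x<..} g * (g\<^sup>2 - x * g - 1)) = 0"
proof -
  have int: "integrable lborel (\<lambda>g. (g\<^sup>2 - x * g - 1) * std_phi g)"
  proof -
    have "integrable gauss (\<lambda>g. g\<^sup>2 - x * g - 1)" by simp
    then show ?thesis by (subst (asm) integrable_gauss_iff) auto
  qed
  have deriv: "((\<lambda>g. (x - g) * std_phi g) has_real_derivative (g\<^sup>2 - x * g - 1) * std_phi g) (at g)" for g
    by (rule derivative_eq_intros DERIV_std_phi refl)+ (simp add: algebra_simps power2_eq_square)
  have "(LBINT g=ereal x..\<infinity>. (g\<^sup>2 - x * g - 1) * std_phi g) = 0 - (x - x) * std_phi x"
  proof (rule interval_integral_FTC_integrable)
    show "((\<lambda>g. (x - g) * std_phi g) has_vector_derivative (g\<^sup>2 - x * g - 1) * std_phi g) (at g)" for g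
      using deriv by (simp add: has_real_derivative_iff_has_vector_derivative)
    show "isCont (\<lambda>g. (g\<^sup>2 - x * g - 1) * std_phi g) g" for g
      by (intro continuous_intros isCont_std_phi)
    show "set_integrable lborel (einterval (ereal x) \<infinity>) (\<lambda>g. (g\<^sup>2 - x * g - 1) * std_phi g)"
      unfolding set_integrable_def by (rule integrable_mult_indicator) (use int in auto)
    show "(((\<lambda>g. (x - g) * std_phi g) \<circ> real_of_ereal) \<longlongrightarrow> 0) (at_left \<infinity>)"
      using tendsto_linear_std_phi by (simp add: ereal_tendsto_simps)
    show "(((\<lambda>g. (x - g) * std_phi g) \<circ> real_of_ereal) \<longlongrightarrow> (x - x) * std_phi x) (at_right (ereal x))"
      unfolding ereal_tendsto_simps
      using DERIV_isCont[OF deriv[of x]] by (auto simp: isCont_def intro: filterlim_at_split[THEN iffD1, THEN conjunct2])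
  qed auto
  then have "(LINT g:{x<..}|lborel. (g\<^sup>2 - x * g - 1) * std_phi g) = 0"
    by (simp add: interval_integral_to_infinity_eq)
  then show ?thesis
    by (subst integral_gauss_eq) (auto simp: set_lebesgue_integral_def mult.assoc)
qed

lemma integrable_gauss_signed_square: "integrable gauss (\<lambda>g. (x - g) * \<bar>x - g\<bar>)"
proof (rule Bochner_Integration.integrable_bound)
  show "integrable gauss (\<lambda>g. x\<^sup>2 - 2 * x * g + g\<^sup>2)" by simp
  show "AE g in gauss. norm ((x - g) * \<bar>x - g\<bar>) \<le> norm (x\<^sup>2 - 2 * x * g + g\<^sup>2)"
  proof (rule AE_I2)
    fix g
    have "x\<^sup>2 - 2 * x * g + g\<^sup>2 = (x - g)\<^sup>2" by (simp add: power2_diff)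
    then show "norm ((x - g) * \<bar>x - g\<bar>) \<le> norm (x\<^sup>2 - 2 * x * g + g\<^sup>2)"
      by (simp add: abs_mult power2_eq_square)
  qed
qed measurable

text \<open>A form of the Mills ratio bound \<open>x * std_Phi (- x) \<le> std_phi x\<close>: for \<open>0 \<le> x < g\<close> one
  has \<open>(g - x)\<^sup>2 \<le> g\<^sup>2 - x * g\<close>, and the Gaussian integral of \<open>g\<^sup>2 - x * g - 1\<close> over \<open>g > x\<close> vanishes.\<close>

lemma integral_gauss_signed_square_ge:
  assumes "0 \<le> x"
  shows "x\<^sup>2 + std_Psi x \<le> (LINT g|gauss. (x - g) * \<bar>x - g\<bar>)"
proof -
  have i1: "integrable gauss (\<lambda>g. indicator {x<..} g * (g\<^sup>2 - x * g - 1))"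
    using integrable_mult_indicator[of "{x<..}" gauss "\<lambda>g. g\<^sup>2 - x * g - 1"] by simp
  have i2: "integrable gauss (\<lambda>g. indicator {..x} g :: real)"
    by (intro integrable_real_indicator) (auto simp: less_top[symmetric])
  \<comment> \<open>The signed square is \<open>(x - g)^2\<close> minus twice
    \<open>(g - x)^2\<close> on \<open>g > x\<close>. Replacing the latter by
    \<open>g^2 - x * g\<close> and splitting off 1 leaves a term of mean zero and the tail
    probability \<open>1 - std_Phi x\<close>.\<close>
  have "x\<^sup>2 + std_Psi x = (LINT g|gauss. x\<^sup>2 - 2 * x * g + g\<^sup>2
      - 2 * (indicator {x<..} g * (g\<^sup>2 - x * g - 1)) - 2 * (1 - indicator {..x} g))"
    using i1 i2 gauss.prob_space integral_gauss_tail_eq_0[of x]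
    by (simp add: std_Psi_def std_Phi_eq_measure)
  also have "\<dots> \<le> (LINT g|gauss. (x - g) * \<bar>x - g\<bar>)"
  proof (intro integral_mono)
    fix g
    show "x\<^sup>2 - 2 * x * g + g\<^sup>2 - 2 * (indicator {x<..} g * (g\<^sup>2 - x * g - 1)) - 2 * (1 - indicator {..x} g)
      \<le> (x - g) * \<bar>x - g\<bar>"
    proof (cases "x < g")
      case True
      then have "x * x \<le> x * g" using assms by (intro mult_left_mono) auto
      then show ?thesis using True by (simp add: power2_eq_square algebra_simps)
    qed (simp add: power2_eq_square algebra_simps)
  qed (use i1 i2 integrable_gauss_signed_square in auto)
  finally show ?thesis .
qed

lemma DERIV_mult_abs: "((\<lambda>x::real. x * \<bar>x\<bar>) has_real_derivative 2 * \<bar>x\<bar>) (at x)"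
proof (cases "x = 0")
  case True
  have "((\<lambda>h::real. \<bar>h\<bar>) \<longlongrightarrow> 0) (at 0)"
    by (rule tendsto_eq_intros refl | simp)+
  then have "((\<lambda>h::real. (h * \<bar>h\<bar>) / h) \<longlongrightarrow> 0) (at 0)"
    by (rule Lim_transform_eventually) (auto simp: eventually_at_filter)
  then show ?thesis using True by (simp add: DERIV_def)
next
  case False
  then consider "0 < x" | "x < 0" by linarith
  then show ?thesis
  proof cases
    case 1
    have "((\<lambda>x. x * x) has_real_derivative 2 * \<bar>x\<bar>) (at x)"
      using 1 by (auto intro!: derivative_eq_intros)
    then show ?thesis
      by (rule has_field_derivative_transform_within_open[of _ _ _ "{0<..}"]) (use 1 in auto)
  next
    case 2
    have "((\<lambda>x. - (x * x)) has_real_derivative 2 * \<bar>x\<bar>) (at x)"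
      using 2 by (auto intro!: derivative_eq_intros)
    then show ?thesis
      by (rule has_field_derivative_transform_within_open[of _ _ _ "{..<0}"]) (use 2 in auto)
  qed
qed

lemma DERIV_max_cube: "((\<lambda>x::real. (max 0 x) ^ 3) has_real_derivative 3 * (max 0 x)\<^sup>2) (at x)"
proof -
  have *: "(max 0 x) ^ 3 = (x ^ 3 + x * (x * \<bar>x\<bar>)) / 2" for x :: real
    by (cases "0 \<le> x") (simp_all add: max_def power3_eq_cube)
  show ?thesis
    unfolding *
    by (rule DERIV_cong[OF DERIV_cdivide[OF DERIV_add[OF DERIV_pow[of 3 x]
            DERIV_mult[OF DERIV_ident DERIV_mult_abs[of x]]]]])
       (cases "0 \<le> x"; simp add: max_def power2_eq_square)
qed

text \<open>The odd extension of \<open>N\<^sup>2 / 3 * (1 - (max 0 (1 - x / N)) ^ 3)\<close>, \<open>x \<ge> 0\<close>. Its second derivative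
  is \<open>- 2 * max 0 (1 - x / N)\<close>: this is the test function whose image under the generator of the
  driftless process is the tent that minorises \<open>1 - x / N\<close> and yields the sharp constant.\<close>

definition cubic :: "real \<Rightarrow> real \<Rightarrow> real" where
  "cubic N x = N * x - x * \<bar>x\<bar> + x ^ 3 / (3 * N)
     - ((max 0 (x - N)) ^ 3 - (max 0 (- x - N)) ^ 3) / (3 * N)"

definition dcubic :: "real \<Rightarrow> real \<Rightarrow> real" where
  "dcubic N x = N * (max 0 (1 - \<bar>x\<bar> / N))\<^sup>2"

lemma cubic_measurable [measurable]: "cubic N \<in> borel_measurable borel"
  unfolding cubic_def by measurable

lemma dcubic_measurable [measurable]: "dcubic N \<in> borel_measurable borel"
  unfolding dcubic_def by measurable

lemma cubic_minus: "cubic N (- x) = - cubic N x"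
  by (simp add: cubic_def diff_divide_distrib)

lemma dcubic_minus: "dcubic N (- x) = dcubic N x"
  by (simp add: dcubic_def)

context
  fixes N :: real
  assumes N_pos: "0 < N"
begin

lemma DERIV_cubic: "(cubic N has_real_derivative dcubic N x) (at x)"
proof -
  have eq: "N - 2 * \<bar>x\<bar> + x\<^sup>2 / N - ((max 0 (x - N))\<^sup>2 + (max 0 (- x - N))\<^sup>2) / N = dcubic N x"
    using N_pos
    by (auto simp: dcubic_def max_def abs_if field_simps power2_eq_square)
  have 1: "((\<lambda>x. (max 0 (x - N)) ^ 3) has_real_derivative 3 * (max 0 (x - N))\<^sup>2 * 1) (at x)"
    by (rule DERIV_chain2[OF DERIV_max_cube]) (auto intro!: derivative_eq_intros)
  have 2: "((\<lambda>x. (max 0 (- x - N)) ^ 3) has_real_derivative 3 * (max 0 (- x - N))\<^sup>2 * (- 1)) (at x)"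
    by (rule DERIV_chain2[OF DERIV_max_cube]) (auto intro!: derivative_eq_intros)
  have "(cubic N has_real_derivative
      N - 2 * \<bar>x\<bar> + x\<^sup>2 / N - ((max 0 (x - N))\<^sup>2 + (max 0 (- x - N))\<^sup>2) / N) (at x)"
    unfolding cubic_def
    by (rule DERIV_cong[OF DERIV_diff[OF DERIV_add[OF DERIV_diff[OF DERIV_cmult_Id DERIV_mult_abs]
            DERIV_cdivide[OF DERIV_pow[of 3 x]]] DERIV_cdivide[OF DERIV_diff[OF 1 2]]]])
       (use N_pos in \<open>simp add: field_simps\<close>)
  then show ?thesis by (simp only: eq)
qed

lemma dcubic_antimono: "\<bar>x\<bar> \<le> \<bar>y\<bar> \<Longrightarrow> dcubic N y \<le> dcubic N x"
  using N_pos unfolding dcubic_def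
  by (intro mult_left_mono power_mono) (auto simp: divide_right_mono max_def)

lemma dcubic_nonneg: "0 \<le> dcubic N x"
  using N_pos by (simp add: dcubic_def)

lemma dcubic_le: "dcubic N x \<le> N"
  using dcubic_antimono[of 0 x] by (simp add: dcubic_def)

lemma dcubic_lipschitz: "\<bar>dcubic N x - dcubic N y\<bar> \<le> 2 * \<bar>x - y\<bar>"
proof -
  define u v where "u = max 0 (1 - \<bar>x\<bar> / N)" and "v = max 0 (1 - \<bar>y\<bar> / N)"
  have "0 \<le> \<bar>x\<bar> / N" "0 \<le> \<bar>y\<bar> / N" using N_pos by auto
  then have uv: "0 \<le> u" "u \<le> 1" "0 \<le> v" "v \<le> 1"
    by (auto simp: u_def v_def)
  have "\<bar>u - v\<bar> \<le> \<bar>\<bar>x\<bar> / N - \<bar>y\<bar> / N\<bar>"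
    unfolding u_def v_def by linarith
  also have "\<dots> = \<bar>\<bar>x\<bar> - \<bar>y\<bar>\<bar> / N"
    using N_pos by (simp add: diff_divide_distrib[symmetric])
  also have "\<dots> \<le> \<bar>x - y\<bar> / N"
    using N_pos by (intro divide_right_mono) auto
  finally have "N * \<bar>u - v\<bar> \<le> \<bar>x - y\<bar>"
    using N_pos by (simp add: field_simps)
  then have "N * \<bar>u - v\<bar> * \<bar>u + v\<bar> \<le> \<bar>x - y\<bar> * 2"
    using uv by (intro mult_mono) auto
  moreover have "dcubic N x - dcubic N y = N * ((u - v) * (u + v))"
    by (simp add: dcubic_def u_def v_def power2_eq_square algebra_simps)
  ultimately show ?thesis
    using N_pos by (simp add: abs_mult mult_ac)
qed

lemma cubic_mono: "x \<le> y \<Longrightarrow> cubic N x \<le> cubic N y"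
  by (rule DERIV_nonneg_imp_nondecreasing) (use DERIV_cubic dcubic_nonneg in blast)+

lemma cubic_eq: "0 \<le> x \<Longrightarrow> x \<le> N \<Longrightarrow> cubic N x = N * x - x * \<bar>x\<bar> + x ^ 3 / (3 * N)"
  using N_pos by (simp add: cubic_def max_def)

lemma cubic_eq_const: "N \<le> x \<Longrightarrow> cubic N x = N\<^sup>2 / 3"
  using N_pos by (simp add: cubic_def max_def field_simps power2_eq_square power3_eq_cube)

lemma cubic_le: "cubic N x \<le> N\<^sup>2 / 3"
  using cubic_mono[of x "max x N"] cubic_eq_const[of "max x N"] by simp

lemma abs_cubic_le: "\<bar>cubic N x\<bar> \<le> N\<^sup>2 / 3"
  using cubic_le[of x] cubic_le[of "- x"] unfolding cubic_minus by (rule abs_leI)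

lemma integrable_cubic: "integrable gauss (\<lambda>g. cubic N (a - c * g))"
  by (rule integrable_gauss_bounded[OF _ abs_cubic_le]) simp

lemma integrable_dcubic: "integrable gauss (\<lambda>g. dcubic N (a - c * g))"
  by (rule integrable_gauss_bounded[where B=N]) (auto simp: dcubic_le dcubic_nonneg)

text \<open>The Gaussian average of one step in the units \<open>w = 2 * s * x\<close>. The factor 1
  keeps the shape \<open>a - c * g\<close> of the lemmas on odd functions.\<close>

definition smooth_cubic :: "real \<Rightarrow> real" where
  "smooth_cubic x = (LINT g|gauss. cubic N (x - 1 * g))"

definition smooth_dcubic :: "real \<Rightarrow> real" where
  "smooth_dcubic x = (LINT g|gauss. dcubic N (x - 1 * g))"

lemma DERIV_smooth_cubic: "(smooth_cubic has_real_derivative smooth_dcubic x) (at x)"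
proof -
  have "((\<lambda>x. LINT g|gauss. cubic N (x + - g)) has_real_derivative (LINT g|gauss. dcubic N (x + - g))) (at x)"
    using DERIV_cubic dcubic_lipschitz integrable_cubic[of _ 1] integrable_dcubic[of _ 1]
    by (intro DERIV_integral_translate[where C=2] prob_space_gauss) auto
  then show ?thesis
    by (simp add: smooth_cubic_def[abs_def] smooth_dcubic_def)
qed

text \<open>Around the midpoint \<open>c\<close>, the difference of the translates by
  \<open>- h\<close> and \<open>h\<close> is odd, because \<open>dcubic\<close> is even, and
  nonnegative on the half-line, because \<open>dcubic\<close> decreases in the modulus. The lemma
  says that \<open>smooth_cubic\<close> is concave there.\<close>

lemma smooth_dcubic_antimono:
  assumes "0 \<le> x" "x \<le> y"
  shows "smooth_dcubic y \<le> smooth_dcubic x"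
proof -
  define c h where "c = (x + y) / 2" and "h = (y - x) / 2"
  have ch: "x = c - h" "y = c + h" "0 \<le> c" "0 \<le> h"
    using assms by (auto simp: c_def h_def field_simps)
  let ?q = "\<lambda>t. dcubic N (t - h) - dcubic N (t + h)"
  have int: "integrable gauss (\<lambda>g. dcubic N (c - 1 * g - h))" "integrable gauss (\<lambda>g. dcubic N (c - 1 * g + h))"
    using integrable_dcubic[of "c - h" 1] integrable_dcubic[of "c + h" 1] by (auto simp: algebra_simps)
  have "0 \<le> (LINT g|gauss. ?q (c - 1 * g))"
  proof (rule integral_gauss_odd_nonneg)
    show "?q (- t) = - ?q t" for t
    proof -
      have "- t - h = - (t + h)" "- t + h = - (t - h)" by auto
      then show ?thesis by (simp only: dcubic_minus)
    qed
    show "0 \<le> ?q t" if "0 \<le> t" for t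
      using that ch dcubic_antimono[of "t - h" "t + h"] by simp
  qed (use ch int in auto)
  also have "\<dots> = smooth_dcubic x - smooth_dcubic y"
    using int by (simp add: smooth_dcubic_def ch algebra_simps)
  finally show ?thesis by simp
qed

lemma smooth_dcubic_nonneg: "0 \<le> smooth_dcubic x"
  unfolding smooth_dcubic_def by (intro Bochner_Integration.integral_nonneg dcubic_nonneg)

lemma smooth_cubic_0: "smooth_cubic 0 = 0"
  using integral_gauss_minus[of "cubic N"] by (simp add: smooth_cubic_def cubic_minus)

lemma smooth_cubic_le: "smooth_cubic x \<le> N\<^sup>2 / 3"
proof -
  have "smooth_cubic x \<le> (LINT g|gauss. N\<^sup>2 / 3)"
    unfolding smooth_cubic_def
    by (rule integral_mono[OF integrable_cubic]) (use cubic_le in simp_all)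
  then show ?thesis using gauss.prob_space by simp
qed

lemma smooth_cubic_mono: "x \<le> y \<Longrightarrow> smooth_cubic x \<le> smooth_cubic y"
  by (rule DERIV_nonneg_imp_nondecreasing) (use DERIV_smooth_cubic smooth_dcubic_nonneg in blast)+

lemma smooth_cubic_diff:
  assumes "0 \<le> x" "x \<le> y"
  shows "smooth_cubic y - smooth_cubic x \<le> (y - x) * smooth_dcubic x"
    and "(y - x) * smooth_dcubic y \<le> smooth_cubic y - smooth_cubic x"
proof -
  have "smooth_cubic y - smooth_cubic x \<le> (y - x) * smooth_dcubic x
    \<and> (y - x) * smooth_dcubic y \<le> smooth_cubic y - smooth_cubic x"
  proof (cases "x = y")
    case False
    then have "x < y" using assms by simp
    then obtain z where z: "x < z" "z < y" "smooth_cubic y - smooth_cubic x = (y - x) * smooth_dcubic z"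
      using MVT2[of x y smooth_cubic smooth_dcubic] DERIV_smooth_cubic by blast
    then show ?thesis
      using assms smooth_dcubic_antimono[of x z] smooth_dcubic_antimono[of z y]
      by (auto intro!: mult_left_mono)
  qed simp
  then show "smooth_cubic y - smooth_cubic x \<le> (y - x) * smooth_dcubic x"
    and "(y - x) * smooth_dcubic y \<le> smooth_cubic y - smooth_cubic x" by auto
qed

text \<open>The shift costs at most \<open>e\<close> times the slope at 0. The dilation costs at
  most \<open>b * x * smooth_dcubic x\<close>, and by concavity from the origin
  \<open>x * smooth_dcubic x\<close> is at most \<open>smooth_cubic x\<close>, hence at most the
  supremum bound.\<close>

lemma smooth_cubic_increment_le:
  assumes "0 \<le> x" "0 \<le> e" "0 \<le> b"
  shows "smooth_cubic ((1 + b) * x + e) \<le> smooth_cubic x + b * (N\<^sup>2 / 3) + e * smooth_dcubic 0"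
proof -
  have "smooth_cubic ((1 + b) * x + e) - smooth_cubic ((1 + b) * x) \<le> e * smooth_dcubic ((1 + b) * x)"
    using smooth_cubic_diff(1)[of "(1 + b) * x" "(1 + b) * x + e"] assms by simp
  also have "\<dots> \<le> e * smooth_dcubic 0"
    using assms by (intro mult_left_mono smooth_dcubic_antimono) auto
  finally have 1: "smooth_cubic ((1 + b) * x + e) - smooth_cubic ((1 + b) * x) \<le> e * smooth_dcubic 0" .
  have "smooth_cubic ((1 + b) * x) - smooth_cubic x \<le> b * (x * smooth_dcubic x)"
    using smooth_cubic_diff(1)[of x "(1 + b) * x"] assms by (simp add: algebra_simps)
  also have "\<dots> \<le> b * (N\<^sup>2 / 3)"
    using smooth_cubic_diff(2)[of 0 x] smooth_cubic_le[of x] smooth_cubic_0 assms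
    by (intro mult_left_mono) auto
  finally show ?thesis using 1 by simp
qed

text \<open>Dropping the maximum inside the square leaves the first two absolute Gaussian moments.
  If \<open>1 / N \<le> 2 * std_phi 0\<close>, adding the slope \<open>2 * std_phi 0\<close> of
  \<open>std_Psi\<close> gives at most \<open>N\<close>.\<close>

lemma smooth_dcubic_0_le: "smooth_dcubic 0 \<le> N - 4 * std_phi 0 + 1 / N"
proof -
  have "smooth_dcubic 0 \<le> (LINT g|gauss. N - 2 * \<bar>g\<bar> + g\<^sup>2 / N)"
    unfolding smooth_dcubic_def
  proof (rule integral_mono[OF integrable_dcubic])
    fix g :: real
    have "(max 0 (1 - \<bar>g\<bar> / N))\<^sup>2 \<le> (1 - \<bar>g\<bar> / N)\<^sup>2"
      by (auto simp: max_def)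
    then have "dcubic N (0 - 1 * g) \<le> N * (1 - \<bar>g\<bar> / N)\<^sup>2"
      using N_pos by (simp add: dcubic_def)
    also have "\<dots> = N - 2 * \<bar>g\<bar> + g\<^sup>2 / N"
      using N_pos by (simp add: power2_eq_square field_simps)
    finally show "dcubic N (0 - 1 * g) \<le> N - 2 * \<bar>g\<bar> + g\<^sup>2 / N" .
  qed simp
  also have "\<dots> = N - 4 * std_phi 0 + 1 / N"
    using gauss.prob_space by (simp add: integral_gauss_abs)
  finally show ?thesis .
qed

text \<open>One driftless step applied to \<open>cubic\<close> plus \<open>sgn\<close> loses at
  least \<open>1 - x / N\<close> at \<open>x > 0\<close>. Below \<open>N\<close>,
  \<open>cubic\<close> is compared with its polynomial \<open>?p\<close>: the difference is odd and
  nonnegative on the half-line, the signed square supplies \<open>std_Psi x\<close>, and the third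
  moment supplies \<open>x / N\<close>.\<close>

lemma smooth_cubic_plus_Psi_le:
  assumes "0 \<le> x"
  shows "smooth_cubic x + std_Psi x \<le> cubic N x + x / N"
proof (cases "N \<le> x")
  case True
  then have "1 \<le> x / N" using N_pos by simp
  then show ?thesis
    using smooth_cubic_le[of x] cubic_eq_const[OF True] std_Psi_le_1[of x] by linarith
next
  case False
  let ?p = "\<lambda>t. N * t - t * \<bar>t\<bar> + t ^ 3 / (3 * N)"
  let ?r = "\<lambda>t. ?p t - cubic N t"
  have cube: "(x - g) ^ 3 = x ^ 3 - 3 * x\<^sup>2 * g + 3 * x * g\<^sup>2 - g ^ 3" for g
    by (simp add: power3_eq_cube power2_eq_square algebra_simps)
  have int3: "integrable gauss (\<lambda>g. (x - g) ^ 3)"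
    unfolding cube by simp
  have E3: "(LINT g|gauss. (x - g) ^ 3) = x ^ 3 + 3 * x"
    unfolding cube using gauss.prob_space by simp
  have int_p: "integrable gauss (\<lambda>g. ?p (x - 1 * g))"
    using int3 integrable_gauss_signed_square[of x] by simp
  have "0 \<le> (LINT g|gauss. ?r (x - 1 * g))"
  proof (rule integral_gauss_odd_nonneg)
    show "?r (- t) = - ?r t" for t
      by (simp add: cubic_minus)
    show "0 \<le> ?r t" if "0 \<le> t" for t
      using that N_pos by (simp add: cubic_def max_def)
    show "integrable gauss (\<lambda>g. ?r (x - 1 * g))"
      using int_p integrable_cubic by (rule Bochner_Integration.integrable_diff)
  qed (use assms in auto)
  also have "\<dots> = (LINT g|gauss. ?p (x - 1 * g)) - smooth_cubic x"
    unfolding smooth_cubic_def using int_p integrable_cubic by (rule Bochner_Integration.integral_diff)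
  also have "(LINT g|gauss. ?p (x - 1 * g)) = N * x - (LINT g|gauss. (x - g) * \<bar>x - g\<bar>) + (x ^ 3 + 3 * x) / (3 * N)"
    using int3 integrable_gauss_signed_square[of x] gauss.prob_space by (simp add: E3)
  also have "\<dots> \<le> N * x - (x\<^sup>2 + std_Psi x) + (x ^ 3 + 3 * x) / (3 * N)"
    using integral_gauss_signed_square_ge[OF assms] by simp
  also have "\<dots> = cubic N x + x / N - std_Psi x"
    using False assms N_pos by (simp add: cubic_eq power2_eq_square add_divide_distrib)
  finally show ?thesis by simp
qed

end

lemma std_Psi_dilate_le:
  assumes "0 \<le> x" "0 \<le> e" "0 \<le> b"
  shows "std_Psi ((1 + b) * x + e) \<le> std_Psi x + b * (57 / 100) + e * (2 * std_phi 0)"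
proof -
  have "x * std_phi x \<le> 57 / 200"
  proof -
    \<comment> \<open>The square yields \<open>sqrt 2 * x \<le> 1 + x^2 / 2\<close>, hence
      \<open>x * std_phi x \<le> 1 / (2 * sqrt pi)\<close>, which is about 0.282.\<close>
    have "0 \<le> (x / sqrt 2 - 1)\<^sup>2" by simp
    then have "sqrt 2 * x \<le> 1 + x\<^sup>2 / 2"
      by (simp add: power2_eq_square field_simps)
    also have "\<dots> \<le> exp (x\<^sup>2 / 2)"
      by (rule exp_ge_add_one_self)
    finally have "sqrt 2 * x * exp (- (x\<^sup>2 / 2)) \<le> 1"
      by (simp add: exp_minus field_simps)
    then have "sqrt 2 * (sqrt 2 * x * exp (- (x\<^sup>2 / 2))) \<le> sqrt 2 * 1"
      by (intro mult_left_mono) auto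
    moreover have "sqrt 2 * (sqrt 2 * x * exp (- (x\<^sup>2 / 2))) = x * (2 * exp (- (x\<^sup>2 / 2)))"
      by simp
    ultimately have "x * (2 * exp (- (x\<^sup>2 / 2))) \<le> sqrt 2"
      by (simp only: mult_1_right)
    then have "2 * sqrt pi * (x * std_phi x) \<le> 1"
      by (simp add: std_phi_def real_sqrt_mult field_simps)
    moreover have "100 / 57 \<le> sqrt pi"
      using pi_approx by (intro real_le_rsqrt) (simp add: power2_eq_square)
    then have "2 * (100 / 57) * (x * std_phi x) \<le> 2 * sqrt pi * (x * std_phi x)"
      using assms by (intro mult_right_mono) auto
    ultimately show ?thesis by linarith
  qed
  then have *: "b * (x * std_phi x) \<le> b * (57 / 200)"
    using assms(3) by (rule mult_left_mono)
  have "std_Psi ((1 + b) * x) - std_Psi x \<le> ((1 + b) * x - x) * (2 * std_phi x)"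
    using assms by (intro std_Psi_diff_le) (auto simp: algebra_simps)
  also have "\<dots> = 2 * (b * (x * std_phi x))"
    by (simp add: algebra_simps)
  finally show ?thesis
    using * std_Psi_increment_le[of "(1 + b) * x" e] assms by simp
qed

section \<open>The mass of the positive half-line from the cubic test function\<close>

context sticky_chain_bound
begin

text \<open>The integral of \<open>f\<close> cancels from the stationary inequality. What remains is
  the loss \<open>1 - w / (2 * s * N)\<close> on \<open>w > 0\<close> against the cost
  \<open>k\<close> of the dilation by \<open>1 + \<gamma> * L\<close> and the cost
  \<open>e * N\<close> of the drift, \<open>N\<close> bounding the total slope at 0.\<close>

lemma measure_pos_le:
  assumes N: "0 < N" "1 / N \<le> 2 * std_phi 0"
  shows "(1 - \<gamma> * L * (N\<^sup>2 / 3 + 57 / 100)) * measure \<mu> {0<..}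
    \<le> \<gamma> * cinf * N / (2 * s) + (\<integral>w. w \<partial>\<mu>) / (2 * s * N)"
proof -
  define f where "f w = cubic N (w / (2 * s)) + sgn w" for w
  define e where "e = \<gamma> * cinf / (2 * s)"
  define k where "k = \<gamma> * L * (N\<^sup>2 / 3 + 57 / 100)"
  have [measurable]: "f \<in> borel_measurable borel"
    unfolding f_def by measurable
  have e: "0 \<le> e" using gamma_pos cinf_nonneg s_pos by (simp add: e_def)
  have b: "0 \<le> \<gamma> * L" using gamma_pos L_nonneg by simp
  have f_bound: "\<bar>f w\<bar> \<le> N\<^sup>2 / 3 + 1" for w
  proof -
    have "\<bar>sgn w\<bar> \<le> 1" by (simp add: abs_sgn_eq)
    then show ?thesis
      using abs_cubic_le[OF N(1), of "w / (2 * s)"] unfolding f_def by linarith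
  qed
  have int_f: "integrable \<mu> f"
    using f_bound by (intro integrable_const_bound[where B="N\<^sup>2 / 3 + 1"]) auto
  have int_ind: "integrable \<mu> (\<lambda>w. indicator {0<..} w :: real)"
    by (intro integrable_real_indicator) (auto simp: less_top[symmetric])
  have slope: "smooth_dcubic N 0 + 2 * std_phi 0 \<le> N"
    using smooth_dcubic_0_le[OF N(1)] N(2) by linarith
  then have e_slope: "e * smooth_dcubic N 0 + e * (2 * std_phi 0) \<le> e * N"
    using e by (simp add: distrib_left[symmetric] mult_left_mono)
  define h where "h w = f w - (1 - k) * indicator {0<..} w + w / (2 * s * N) + e * N" for w
  have "(\<integral>w. f w \<partial>\<mu>) \<le> (\<integral>w. h w \<partial>\<mu>)"
  proof (rule stationary_odd[where B="N\<^sup>2 / 3 + 1"])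
    show "f (- w) = - f w" for w
      using cubic_minus[of N "w / (2 * s)"] by (simp add: f_def sgn_minus)
    show "integrable \<mu> h"
      unfolding h_def using int_f int_ind integrable_id by simp
    fix w :: real assume w: "0 \<le> w"
    let ?a = "\<tau> w + \<gamma> * cinf" and ?x = "w / (2 * s)"
    have x: "0 \<le> ?x" using w s_pos by simp
    have "?a / (2 * s) \<le> ((1 + \<gamma> * L) * w + \<gamma> * cinf) / (2 * s)"
      using tau_L[OF w] s_pos by (intro divide_right_mono) auto
    also have "\<dots> = (1 + \<gamma> * L) * ?x + e"
      by (simp add: e_def add_divide_distrib)
    finally have a: "?a / (2 * s) \<le> (1 + \<gamma> * L) * ?x + e" .
    have scale: "(?a - 2 * s * g) / (2 * s) = ?a / (2 * s) - 1 * g" for g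
      using s_pos by (simp add: field_simps)
    have "(LINT g|gauss. f (?a - 2 * s * g)) =
        (LINT g|gauss. cubic N (?a / (2 * s) - 1 * g)) + (LINT g|gauss. sgn (?a - (2 * s) * g))"
      unfolding f_def scale
      by (intro Bochner_Integration.integral_add integrable_cubic N(1) integrable_gauss_bounded[where B=1])
         (auto simp: abs_sgn_eq)
    also have "\<dots> = smooth_cubic N (?a / (2 * s)) + std_Psi (?a / (2 * s))"
      using s_pos by (subst integral_gauss_sgn) (auto simp: smooth_cubic_def[OF N(1)])
    also have "\<dots> \<le> smooth_cubic N ((1 + \<gamma> * L) * ?x + e) + std_Psi ((1 + \<gamma> * L) * ?x + e)"
      using a by (intro add_mono smooth_cubic_mono[OF N(1)] std_Psi_mono)
    also have "\<dots> \<le> h w"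
    \<comment> \<open>At 0 the term \<open>sgn\<close> gives no gain, which is why the indicator in
      \<open>h\<close> excludes 0; only the drift has to be paid.\<close>
    proof (cases "w = 0")
      case True
      then show ?thesis
        using smooth_cubic_increment_le[OF N(1), of 0 e 0] std_Psi_dilate_le[of 0 e 0] e e_slope
        by (simp add: h_def f_def smooth_cubic_0[OF N(1)] cubic_def max_def N(1)[THEN less_imp_le])
    next
      case False
      have "smooth_cubic N ((1 + \<gamma> * L) * ?x + e) + std_Psi ((1 + \<gamma> * L) * ?x + e)
        \<le> smooth_cubic N ?x + std_Psi ?x + k + e * N"
        using smooth_cubic_increment_le[OF N(1) x e b] std_Psi_dilate_le[OF x e b] e_slope
        by (simp add: k_def distrib_left)
      also have "\<dots> \<le> cubic N ?x + ?x / N + k + e * N"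
        using smooth_cubic_plus_Psi_le[OF N(1) x] by simp
      also have "\<dots> = h w"
        using False w by (simp add: h_def f_def)
      finally show ?thesis .
    qed
    finally show "(LINT g|gauss. f (?a - 2 * s * g)) \<le> h w" .
  qed (use f_bound in auto)
  also have "\<dots> = (\<integral>w. f w \<partial>\<mu>) - (1 - k) * measure \<mu> {0<..} + (\<integral>w. w \<partial>\<mu>) / (2 * s * N) + e * N"
    unfolding h_def using int_f int_ind integrable_id prob_space by simp
  finally show ?thesis
    by (simp add: k_def e_def)
qed

end

section \<open>The constants\<close>

text \<open>Chebyshev's inequality: \<open>t^2 \<le> g^2\<close> on the tail. It bounds the set
  whose supremum enters \<open>zeta\<close>, so that single values bound this supremum from
  below.\<close>

lemma square_mult_std_Phi_minus_le:
  assumes "0 \<le> t"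
  shows "t\<^sup>2 * std_Phi (- t) \<le> 1"
proof -
  have "t\<^sup>2 * std_Phi (- t) = (LINT g|gauss. t\<^sup>2 * indicator {..- t} g)"
    by (simp add: std_Phi_eq_measure)
  also have "\<dots> \<le> (LINT g|gauss. g\<^sup>2)"
  proof (rule integral_mono)
    show "integrable gauss (\<lambda>g. t\<^sup>2 * indicator {..- t} g)"
      by (intro integrable_mult_right integrable_real_indicator) (auto simp: less_top[symmetric])
    show "t\<^sup>2 * indicator {..- t} g \<le> g\<^sup>2" for g
      using assms by (cases "g \<le> - t") (auto simp: abs_le_square_iff[symmetric])
  qed simp
  finally show ?thesis by simp
qed

text \<open>Integrate \<open>exp (- u) \<le> 1 - u + u^2 / 2\<close> with
  \<open>u = x^2 / 2\<close>. The latter follows from the quadratic lower bound for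
  \<open>exp u\<close>, since the two quadratics multiply to \<open>1 + u^4 / 4\<close>.\<close>

lemma std_Phi_le_taylor:
  assumes "0 \<le> t"
  shows "std_Phi t \<le> 1 / 2 + std_phi 0 * (t - t ^ 3 / 6 + t ^ 5 / 40)"
proof -
  let ?K = "\<lambda>t. std_phi 0 * (t - t ^ 3 / 6 + t ^ 5 / 40) - std_Phi t"
  have deriv: "(?K has_real_derivative std_phi 0 * (1 - x\<^sup>2 / 2 + x ^ 4 / 8) - std_phi x) (at x)" for x
    by (auto intro!: derivative_eq_intros DERIV_std_Phi simp: field_simps)
  have "0 \<le> std_phi 0 * (1 - x\<^sup>2 / 2 + x ^ 4 / 8) - std_phi x" for x
  proof -
    define u where "u = x\<^sup>2 / 2"
    have u: "0 \<le> u" "x ^ 4 = 4 * u\<^sup>2" by (auto simp: u_def power2_eq_square eval_nat_numeral)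
    have "(1 + u + u\<^sup>2 / 2) * (1 - u + u\<^sup>2 / 2) = 1 + (u\<^sup>2)\<^sup>2 / 4"
      by (simp add: power2_eq_square algebra_simps)
    then have "1 \<le> (1 + u + u\<^sup>2 / 2) * (1 - u + u\<^sup>2 / 2)"
      by simp
    also have "0 \<le> (1 - u)\<^sup>2 + 1" by simp
    then have "0 \<le> 1 - u + u\<^sup>2 / 2" by (simp add: power2_eq_square algebra_simps)
    then have "(1 + u + u\<^sup>2 / 2) * (1 - u + u\<^sup>2 / 2) \<le> exp u * (1 - u + u\<^sup>2 / 2)"
      by (intro mult_right_mono exp_lower_Taylor_quadratic u(1))
    finally have "exp (- u) \<le> 1 - u + u\<^sup>2 / 2"
      by (simp add: exp_minus field_simps)
    then have "exp (- u) / sqrt (2 * pi) \<le> (1 - u + u\<^sup>2 / 2) / sqrt (2 * pi)"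
      by (intro divide_right_mono) auto
    then show ?thesis
      by (simp add: std_phi_def u(2) flip: u_def)
  qed
  then have "?K 0 \<le> ?K t"
    using assms deriv by (intro DERIV_nonneg_imp_nondecreasing[of 0 t ?K]) blast+
  then show ?thesis by simp
qed

text \<open>The left side is the value for which twice the supremum plus \<open>1 / 4\<close> is
  \<open>pi / 2 - 1\<close>, as \<open>zeta_ge\<close> needs. The witness \<open>11 / 10\<close>
  gives about 0.1615 against about 0.1604.\<close>

lemma Sup_square_mult_std_Phi_ge:
  "pi / 4 - 5 / 8 \<le> Sup ((\<lambda>t. t\<^sup>2 * std_Phi (- t)) ` {0..})"
proof -
  have "1000 / 399 \<le> sqrt (2 * pi)"
    using pi_approx by (intro real_le_rsqrt) (simp add: power2_eq_square)
  then have phi: "std_phi 0 \<le> 399 / 1000"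
    unfolding std_phi_0 by (simp add: field_simps)
  have "std_Phi (11 / 10) \<le> 1 / 2 + std_phi 0 * (11 / 10 - (11 / 10) ^ 3 / 6 + (11 / 10) ^ 5 / 40)"
    by (rule std_Phi_le_taylor) simp
  also have "\<dots> \<le> 1 / 2 + 399 / 1000 * (11 / 10 - (11 / 10) ^ 3 / 6 + (11 / 10) ^ 5 / 40)"
    using phi by (intro add_left_mono mult_right_mono) (simp_all add: eval_nat_numeral)
  finally have "std_Phi (11 / 10) \<le> 8665 / 10000"
    by (simp add: eval_nat_numeral)
  then have "pi / 4 - 5 / 8 \<le> (11 / 10)\<^sup>2 * std_Phi (- (11 / 10))"
    using pi_approx unfolding std_Phi_minus by (simp add: power2_eq_square)
  also have "\<dots> \<le> Sup ((\<lambda>t. t\<^sup>2 * std_Phi (- t)) ` {0..})"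
  proof (rule cSup_upper)
    show "bdd_above ((\<lambda>t. t\<^sup>2 * std_Phi (- t)) ` {0..})"
      using square_mult_std_Phi_minus_le by (intro bdd_aboveI2[where M=1]) auto
  qed auto
  finally show ?thesis .
qed

text \<open>The \<open>zeta\<close> terms of the constants are there to pay for the excess of
  \<open>pi / 2\<close> over 1 in the coefficient of \<open>std_phi 0 / \<sigma>\<close>; this is
  the amount available.\<close>

lemma zeta_ge:
  assumes "0 < \<sigma>" "0 \<le> \<gamma>b" "0 \<le> L"
  shows "(pi / 2 - 1) * std_phi 0 / \<sigma> \<le> 2 * zeta \<sigma> \<gamma>b L / \<sigma> ^ 3"
proof -
  define S where "S = Sup ((\<lambda>t. t\<^sup>2 * std_Phi (- t)) ` {0..})"
  have S: "pi / 2 - 1 \<le> 2 * (S + 1 / 8)"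
    using Sup_square_mult_std_Phi_ge by (simp add: S_def)
  have "1 \<le> (1 + \<gamma>b * L)\<^sup>2"
    using assms by (intro one_le_power) simp
  then have "1 * (pi / 2 - 1) \<le> (1 + \<gamma>b * L)\<^sup>2 * (2 * (S + 1 / 8))"
    using S pi_gt3 by (intro mult_mono) auto
  then have "(pi / 2 - 1) * (std_phi 0 / \<sigma>) \<le> (1 + \<gamma>b * L)\<^sup>2 * (2 * (S + 1 / 8)) * (std_phi 0 / \<sigma>)"
    using assms by (intro mult_right_mono) auto
  also have "\<dots> = 2 * zeta \<sigma> \<gamma>b L / \<sigma> ^ 3"
    using assms(1) unfolding zeta_def S_def[symmetric] std_phi_0
    by (simp add: divide_simps power2_eq_square power3_eq_cube)
  finally show ?thesis by simp
qed

text \<open>This absorbs the factor in front of the mass in \<open>measure_pos_le\<close> into an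
  exponential. Squaring the quadratic bound for \<open>exp (y / 2)\<close> gives the accuracy needed
  up to \<open>5 / 4\<close>.\<close>

lemma exp_mult_linear_ge_1:
  fixes y :: real
  assumes "0 \<le> y" "y \<le> 5 / 4"
  shows "1 \<le> exp y * (1 - 547 / 1000 * y)"
proof -
  have "1 + y / 2 + (y / 2)\<^sup>2 / 2 \<le> exp (y / 2)"
    using assms by (intro exp_lower_Taylor_quadratic) simp
  then have "(1 + y / 2 + (y / 2)\<^sup>2 / 2)\<^sup>2 \<le> (exp (y / 2))\<^sup>2"
    using assms by (intro power_mono) auto
  also have "(exp (y / 2))\<^sup>2 = exp y"
    by (simp add: power2_eq_square exp_add[symmetric])
  finally have "(1 + y / 2 + (y / 2)\<^sup>2 / 2)\<^sup>2 * (1 - 547 / 1000 * y) \<le> exp y * (1 - 547 / 1000 * y)"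
    using assms by (intro mult_right_mono) auto
  moreover have "(1 + y / 2 + (y / 2)\<^sup>2 / 2)\<^sup>2 * (1 - 547 / 1000 * y)
      = 1 + y * (453 / 1000 - 47 / 1000 * y - 297 / 2000 * y ^ 2 - 211 / 4000 * y ^ 3 - 547 / 64000 * y ^ 4)"
    by (simp add: eval_nat_numeral field_simps)
  moreover have "0 \<le> y * (453 / 1000 - 47 / 1000 * y - 297 / 2000 * y ^ 2 - 211 / 4000 * y ^ 3 - 547 / 64000 * y ^ 4)"
  proof (rule mult_nonneg_nonneg[OF assms(1)])
    have "y ^ k \<le> (5 / 4) ^ k" for k
      using assms by (intro power_mono)
    from this[of 2] this[of 3] this[of 4] assms(2)
    show "0 \<le> 453 / 1000 - 47 / 1000 * y - 297 / 2000 * y ^ 2 - 211 / 4000 * y ^ 3 - 547 / 64000 * y ^ 4"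
      by (simp add: eval_nat_numeral)
  qed
  ultimately show ?thesis by linarith
qed

section \<open>Matching the estimates with \<open>eta1\<close>, \<open>const_c1\<close> and
  \<open>const_c2\<close>\<close>

context sticky_chain_bound
begin

lemma measure_near_0_le_eta1:
  assumes "\<gamma> \<le> \<gamma>b" "0 < \<delta>"
  shows "measure \<mu> {0<..R1} \<le> cinf * eta1 \<sigma> \<gamma>b L R1 cinf \<delta>"
proof -
  define X where "X = (\<delta> + \<gamma>b) * L"
  \<comment> \<open>Rounding up puts \<open>\<gamma> * n\<close> between \<open>\<delta>\<close> and
    \<open>\<delta> + \<gamma>b\<close>: the lower end controls the argument of
    \<open>std_Phi\<close>, the upper end the cost.\<close>
  define n where "n = nat \<lceil>\<delta> / \<gamma>\<rceil>"
  let ?D = "sqrt (\<delta> + \<gamma>b)"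
  have pos: "0 < \<gamma>b" "0 \<le> X"
    using assms gamma_pos L_nonneg by (auto simp: X_def)
  have "0 < \<delta> / \<gamma>" using assms gamma_pos by simp
  then have n: "0 < n" "\<delta> / \<gamma> \<le> real n" "real n \<le> \<delta> / \<gamma> + 1"
    unfolding n_def by linarith+
  then have n\<gamma>: "\<delta> \<le> \<gamma> * real n" "\<gamma> * real n \<le> \<delta> + \<gamma>b"
    using gamma_pos assms by (auto simp: field_simps)
  have s_sqrt: "s * sqrt n = \<sigma> * sqrt (\<gamma> * n)"
    by (simp add: s_def real_sqrt_mult)
  have "\<alpha> ^ n \<le> exp (\<gamma> * L) ^ n"
    using alpha_ge_1 unfolding \<alpha>_def by (intro power_mono) auto
  also have "\<dots> = exp (\<gamma> * real n * L)"
    by (simp add: exp_of_nat_mult[symmetric] mult_ac)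
  also have "\<dots> \<le> exp X"
    using n\<gamma> L_nonneg by (simp add: X_def mult_right_mono)
  finally have alpha_n: "\<alpha> ^ n \<le> exp X" .
  define P where "P = std_Phi (- (((1 + \<gamma>b * L) * R1 + (\<delta> + \<gamma>b) * cinf) / (2 * sqrt \<delta> * \<sigma> * exp (- X))))"
  have P: "0 < P" by (simp add: P_def)
  have "\<alpha> ^ n * R1 / (2 * s * sqrt n) \<le> exp X * ((1 + \<gamma>b * L) * R1 + (\<delta> + \<gamma>b) * cinf) / (2 * sqrt \<delta> * \<sigma>)"
  proof (rule frac_le)
    have "1 * R1 \<le> (1 + \<gamma>b * L) * R1"
      using pos L_nonneg R1_nonneg by (intro mult_right_mono) auto
    moreover have "0 \<le> (\<delta> + \<gamma>b) * cinf"
      using pos assms cinf_nonneg by simp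
    ultimately have R: "R1 \<le> (1 + \<gamma>b * L) * R1 + (\<delta> + \<gamma>b) * cinf" by simp
    then show "\<alpha> ^ n * R1 \<le> exp X * ((1 + \<gamma>b * L) * R1 + (\<delta> + \<gamma>b) * cinf)"
      using alpha_n R1_nonneg by (intro mult_mono) auto
    show "0 \<le> exp X * ((1 + \<gamma>b * L) * R1 + (\<delta> + \<gamma>b) * cinf)"
      using R R1_nonneg by simp
    show "2 * sqrt \<delta> * \<sigma> \<le> 2 * s * sqrt n"
      using s_sqrt n\<gamma> sigma_pos by (simp add: mult.assoc mult.commute)
  qed (use sigma_pos assms in simp)
  also have "\<dots> = ((1 + \<gamma>b * L) * R1 + (\<delta> + \<gamma>b) * cinf) / (2 * sqrt \<delta> * \<sigma> * exp (- X))"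
  proof -
    have "exp X * y / z = y / (z * exp (- X))" for y z
      by (simp add: exp_minus divide_inverse)
    then show ?thesis .
  qed
  finally have "P \<le> std_Phi (- (\<alpha> ^ n * R1 / (2 * s * sqrt n)))"
    unfolding P_def by (intro std_Phi_mono) simp
  then have "P * measure \<mu> {0<..R1} \<le> std_Phi (- (\<alpha> ^ n * R1 / (2 * s * sqrt n))) * measure \<mu> {0<..R1}"
    by (intro mult_right_mono) auto
  also have "\<dots> \<le> std_phi 0 * \<gamma> * cinf / s * (\<alpha> ^ n * sqrt n)"
    by (rule measure_near_0_le[OF n(1)])
  also have "\<dots> = cinf * (std_phi 0 / \<sigma>) * (\<alpha> ^ n * sqrt (\<gamma> * n))"
    using gamma_pos sigma_pos by (simp add: s_def real_sqrt_mult field_simps)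
  also have "\<dots> \<le> cinf * (std_phi 0 / \<sigma>) * (exp X * ?D)"
    using alpha_n n\<gamma> alpha_ge_1 cinf_nonneg sigma_pos gamma_pos by (intro mult_left_mono mult_mono) auto
  also have "\<dots> \<le> cinf * (?D * (2 * zeta \<sigma> \<gamma>b L * exp (3 * X) / \<sigma> ^ 3 + exp X / (2 * sqrt (2 * pi) * \<sigma>)))"
  proof -
    define f where "f = std_phi 0 / \<sigma>"
    have f: "0 \<le> f" using sigma_pos by (simp add: f_def)
    \<comment> \<open>The last term of \<open>eta1\<close> covers half of \<open>f * exp X\<close>.
      The \<open>zeta\<close> term covers the other half, since
      \<open>pi / 2 - 1 \<ge> 1 / 2\<close>.\<close>
    have "1 / 2 * f * exp X \<le> (pi / 2 - 1) * f * exp (3 * X)"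
      using f pi_gt3 pos by (intro mult_mono) auto
    also have "\<dots> \<le> 2 * zeta \<sigma> \<gamma>b L / \<sigma> ^ 3 * exp (3 * X)"
      using zeta_ge[of \<sigma> \<gamma>b L] sigma_pos pos L_nonneg
      by (intro mult_right_mono) (auto simp: f_def)
    finally have "f * exp X \<le> 2 * zeta \<sigma> \<gamma>b L * exp (3 * X) / \<sigma> ^ 3 + exp X / (2 * sqrt (2 * pi) * \<sigma>)"
      by (simp add: f_def std_phi_0 field_simps)
    then have "cinf * (?D * (f * exp X)) \<le> cinf * (?D * (2 * zeta \<sigma> \<gamma>b L * exp (3 * X) / \<sigma> ^ 3 + exp X / (2 * sqrt (2 * pi) * \<sigma>)))"
      using cinf_nonneg pos assms by (intro mult_left_mono) auto
    then show ?thesis by (simp only: f_def mult_ac)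
  qed
  finally have *: "P * measure \<mu> {0<..R1} \<le> \<dots>" .
  have "eta1 \<sigma> \<gamma>b L R1 cinf \<delta> = ?D * (2 * zeta \<sigma> \<gamma>b L * exp (3 * X) / \<sigma> ^ 3 + exp X / (2 * sqrt (2 * pi) * \<sigma>)) / P"
  proof -
    have "- (\<delta> + \<gamma>b) * L = - X" "3 * (\<delta> + \<gamma>b) * L = 3 * X" "(\<delta> + \<gamma>b) * L = X"
      by (simp_all only: X_def mult_minus_left mult.assoc)
    then show ?thesis
      unfolding eta1_def P_def by (simp only:)
  qed
  then show ?thesis
    using * P by (simp add: pos_le_divide_eq mult.commute)
qed

lemma first_moment_le_c1:
  assumes "\<gamma> \<le> \<gamma>b" "0 < \<delta>"
  shows "(\<integral>\<^sup>+w. ennreal w \<partial>\<mu>) \<le> ennreal (cinf * const_c1 \<sigma> \<gamma>b L m R1 cinf \<delta>)"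
    and "(\<integral>w. w \<partial>\<mu>) \<le> cinf * const_c1 \<sigma> \<gamma>b L m R1 cinf \<delta>"
proof -
  let ?c1 = "const_c1 \<sigma> \<gamma>b L m R1 cinf \<delta>"
  have "(L + m) * R1 * measure \<mu> {0<..R1} \<le> (L + m) * R1 * (cinf * eta1 \<sigma> \<gamma>b L R1 cinf \<delta>)"
    using measure_near_0_le_eta1[OF assms] L_nonneg m_pos R1_nonneg by (intro mult_left_mono) auto
  then have "(cinf + (L + m) * R1 * measure \<mu> {0<..R1}) / m
      \<le> (cinf + (L + m) * R1 * (cinf * eta1 \<sigma> \<gamma>b L R1 cinf \<delta>)) / m"
    using m_pos by (intro divide_right_mono) auto
  also have "\<dots> = cinf * ?c1"
    using m_pos by (simp add: const_c1_def field_simps)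
  finally have le: "(cinf + (L + m) * R1 * measure \<mu> {0<..R1}) / m \<le> cinf * ?c1" .
  then show 1: "(\<integral>\<^sup>+w. ennreal w \<partial>\<mu>) \<le> ennreal (cinf * ?c1)"
    using first_moment_le by (meson ennreal_leI order_trans)
  have "0 \<le> (cinf + (L + m) * R1 * measure \<mu> {0<..R1}) / m"
    using cinf_nonneg L_nonneg m_pos R1_nonneg by simp
  with le have nonneg: "0 \<le> cinf * ?c1" by linarith
  have "ennreal (\<integral>w. w \<partial>\<mu>) = (\<integral>\<^sup>+w. ennreal w \<partial>\<mu>)"
    by (rule nn_integral_eq_integral[symmetric]) (use integrable_id AE_nonneg in auto)
  then show "(\<integral>w. w \<partial>\<mu>) \<le> cinf * ?c1"
    using 1 nonneg by (metis ennreal_le_iff)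
qed

lemma measure_pos_le_c2:
  assumes "\<gamma> \<le> \<gamma>b" "0 < \<delta>" "0 < L \<Longrightarrow> \<delta> \<le> 1 / L"
  shows "measure \<mu> {0<..} \<le> cinf * const_c2 \<sigma> \<gamma>b L m R1 cinf \<delta>"
proof -
  define X where "X = (\<delta> + \<gamma>b) * L"
  define W where "W = cinf * const_c1 \<sigma> \<gamma>b L m R1 cinf \<delta>"
  define f where "f = std_phi 0 / \<sigma>"
  let ?D = "sqrt (\<delta> + \<gamma>b)" and ?M = "measure \<mu> {0<..}"
  define Z where "Z = 2 * zeta \<sigma> \<gamma>b L / \<sigma> ^ 3"
  have pos: "0 < \<gamma>b" "0 \<le> X" "0 < \<delta> + \<gamma>b"
    using assms gamma_pos L_nonneg by (auto simp: X_def)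
  have f: "0 < f" using sigma_pos by (simp add: f_def)
  have EW: "(\<integral>w. w \<partial>\<mu>) \<le> W"
    unfolding W_def by (rule first_moment_le_c1(2)[OF assms(1,2)])
  have "0 \<le> (\<integral>w. w \<partial>\<mu>)"
    using AE_nonneg by (intro integral_nonneg_AE) auto
  with EW have W: "0 \<le> W" by linarith
  have Z: "(pi / 2 - 1) * f \<le> Z"
    using zeta_ge[of \<sigma> \<gamma>b L] sigma_pos pos L_nonneg by (simp add: Z_def f_def)
  then have Z_nonneg: "0 \<le> Z"
    using f pi_gt3 by (intro order_trans[OF _ Z] mult_nonneg_nonneg) auto
  have c2: "cinf * const_c2 \<sigma> \<gamma>b L m R1 cinf \<delta> =
      exp X * f * (W * (1 + \<gamma>b * L) / sqrt \<delta>) + exp X * f * cinf * ?D + cinf * Z * ?D * exp (3 * X)"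
    unfolding const_c2_def W_def Z_def X_def f_def std_phi_0
    by (simp add: distrib_left add_divide_distrib mult_ac)
  show ?thesis
  \<comment> \<open>In the first case \<open>1 / sqrt \<gamma> \<le> exp X / sqrt \<delta>\<close>,
    so the moment coefficient of a single step fits into \<open>const_c2\<close>. In the second,
    \<open>\<gamma>\<close> is small enough compared with \<open>\<delta>\<close> for the cubic
    estimate.\<close>
  proof (cases "\<delta> \<le> \<gamma> * (exp X)\<^sup>2")
    case True
    then have "sqrt \<delta> \<le> sqrt \<gamma> * exp X"
      by (metis abs_exp_cancel real_sqrt_abs real_sqrt_le_iff real_sqrt_mult)
    then have "1 / sqrt \<gamma> \<le> exp X / sqrt \<delta>"
      using gamma_pos assms(2) by (simp add: field_simps)
    have "?M \<le> std_phi 0 / s * (\<alpha> * (\<integral>w. w \<partial>\<mu>) + \<gamma> * cinf)"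
      by (rule measure_pos_le_one_step)
    also have "\<dots> \<le> std_phi 0 / s * ((1 + \<gamma>b * L) * W + \<gamma> * cinf)"
      using s_pos EW \<open>0 \<le> (\<integral>w. w \<partial>\<mu>)\<close> assms(1) L_nonneg gamma_pos
      by (intro mult_left_mono add_mono mult_mono) (auto simp: \<alpha>_def intro!: mult_right_mono)
    also have "\<dots> = f * (1 / sqrt \<gamma> * ((1 + \<gamma>b * L) * W)) + f * cinf * sqrt \<gamma>"
      using gamma_pos sigma_pos by (simp add: s_def f_def field_simps)
    also have "\<dots> \<le> f * (exp X / sqrt \<delta> * ((1 + \<gamma>b * L) * W)) + exp X * f * cinf * ?D"
    proof (intro add_mono mult_left_mono mult_right_mono)
      have "1 * (f * cinf) * sqrt \<gamma> \<le> exp X * (f * cinf) * ?D"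
        using f cinf_nonneg pos assms gamma_pos
        by (intro mult_mono mult_nonneg_nonneg) auto
      then show "f * cinf * sqrt \<gamma> \<le> exp X * f * cinf * ?D" by (simp add: mult.assoc)
    qed (use \<open>1 / sqrt \<gamma> \<le> _\<close> f pos L_nonneg W in auto)
    also have "\<dots> \<le> cinf * const_c2 \<sigma> \<gamma>b L m R1 cinf \<delta>"
    proof -
      have "0 \<le> cinf * Z * ?D * exp (3 * X)"
        using cinf_nonneg Z_nonneg pos by (intro mult_nonneg_nonneg) auto
      then show ?thesis unfolding c2 by (simp add: mult_ac)
    qed
    finally show ?thesis .
  next
    case False
    have E1: "1 \<le> exp X" using pos by simp
    have gd: "\<gamma> \<le> \<delta>"
    proof -
      have "1 \<le> (exp X)\<^sup>2" using E1 by (rule one_le_power)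
      then have "\<gamma> * 1 \<le> \<gamma> * (exp X)\<^sup>2"
        using gamma_pos by (intro mult_left_mono) auto
      then show ?thesis using False by simp
    qed
    define a b where "a = \<delta> * L" and "b = \<gamma> * L"
    have ab: "0 \<le> a" "0 \<le> b" "a \<le> 1" "b \<le> 1 / 4" "b \<le> a" "a + b \<le> X"
    proof -
      show "b \<le> a" unfolding a_def b_def using gd L_nonneg by (intro mult_right_mono)
      show "0 \<le> a" "0 \<le> b" using assms gamma_pos L_nonneg by (auto simp: a_def b_def)
      show "a \<le> 1" using assms(3) L_nonneg by (cases "L = 0") (auto simp: a_def field_simps)
      show "a + b \<le> X"
        unfolding X_def a_def b_def using assms(1) L_nonneg by (simp add: distrib_right mult_right_mono)
      show "b \<le> 1 / 4"
      proof (cases "L = 0")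
        case False
        then have L: "0 < L" using L_nonneg by simp
        \<comment> \<open>The failed inequality gives \<open>b * exp (2 * X) \<le> a\<close>, and
          \<open>exp (2 * X) \<ge> exp (2 * a) \<ge> 4 * a\<close>; cancelling \<open>a\<close>
          leaves \<open>b \<le> 1 / 4\<close>.\<close>
        have "0 \<le> (1 - 2 * a)\<^sup>2 + 1" by simp
        then have "4 * a \<le> 1 + 2 * a + (2 * a)\<^sup>2 / 2"
          by (simp add: power2_eq_square algebra_simps)
        also have "\<dots> \<le> exp (2 * a)"
          using \<open>0 \<le> a\<close> by (intro exp_lower_Taylor_quadratic) simp
        also have "\<dots> \<le> exp (2 * X)"
          using \<open>a + b \<le> X\<close> \<open>0 \<le> b\<close> by simp
        also have "\<dots> = (exp X)\<^sup>2"
          by (simp add: exp_double)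
        finally have "b * (4 * a) \<le> b * (exp X)\<^sup>2"
          using \<open>0 \<le> b\<close> by (rule mult_left_mono)
        also have "\<dots> \<le> a"
          using mult_right_mono[of "\<gamma> * (exp X)\<^sup>2" \<delta> L] \<open>\<not> \<delta> \<le> \<gamma> * (exp X)\<^sup>2\<close> L
          by (simp add: a_def b_def mult_ac)
        finally have "a * (4 * b) \<le> a * 1" by (simp add: mult_ac)
        moreover have "0 < a" using L assms(2) by (simp add: a_def)
        ultimately show ?thesis by (simp add: mult_le_cancel_left_pos)
      qed (simp add: b_def)
    qed
    \<comment> \<open>This makes \<open>2 * s * N\<close> equal to
      \<open>\<sigma> * sqrt (2 * pi * \<delta>)\<close>, so the first moment receives the
      coefficient \<open>f / sqrt \<delta>\<close> of \<open>const_c2\<close>, while the drift term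
      becomes \<open>pi / 2 * f * sqrt \<delta> * cinf\<close>.\<close>
    define N where "N = sqrt (\<delta> / \<gamma>) * sqrt (pi / 2)"
    have N_pos: "0 < N" using assms(2) gamma_pos by (simp add: N_def)
    have sqrt_pi: "sqrt (pi / 2) * (2 * std_phi 0) = 1"
      by (simp add: std_phi_0 real_sqrt_mult real_sqrt_divide field_simps)
    have "1 * 1 \<le> sqrt (\<delta> / \<gamma>) * (sqrt (pi / 2) * (2 * std_phi 0))"
      using gd gamma_pos sqrt_pi by (intro mult_mono) auto
    then have N: "1 / N \<le> 2 * std_phi 0"
      using N_pos by (simp add: N_def[symmetric] pos_divide_le_eq mult_ac)
    have N2: "N\<^sup>2 = \<delta> / \<gamma> * (pi / 2)"
      using assms(2) gamma_pos by (simp add: N_def power_mult_distrib)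
    have "\<gamma> * L * (N\<^sup>2 / 3 + 57 / 100) = a * (pi / 6) + b * (57 / 100)"
      using gamma_pos by (simp add: N2 a_def b_def field_simps)
    also have "\<dots> \<le> a * (524 / 1000) + b * (57 / 100)"
      using ab(1) pi_approx by (intro add_right_mono mult_left_mono) auto
    \<comment> \<open>Here 0.547 is the mean of 0.524 and 0.57; the larger weight sits on
      \<open>b\<close>, and \<open>b \<le> a\<close>.\<close>
    also have "\<dots> \<le> 547 / 1000 * (a + b)"
      using ab by simp
    finally have k: "1 - 547 / 1000 * (a + b) \<le> 1 - \<gamma> * L * (N\<^sup>2 / 3 + 57 / 100)" by simp
    have sN: "2 * s * N = sqrt \<delta> * \<sigma> / std_phi 0"
    proof -
      have "s * sqrt (\<delta> / \<gamma>) = \<sigma> * sqrt \<delta>"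
        using gamma_pos by (simp add: s_def real_sqrt_divide)
      then have "2 * s * N = \<sigma> * sqrt \<delta> * (2 * sqrt (pi / 2))"
        by (simp add: N_def mult_ac)
      also have "2 * sqrt (pi / 2) = 1 / std_phi 0"
        using sqrt_pi std_phi_pos[of 0] by (simp add: field_simps del: std_phi_pos)
      finally show ?thesis by simp
    qed
    have sN': "\<gamma> * N / (2 * s) = pi / 2 * f * sqrt \<delta>"
    proof -
      have "\<gamma> * N / (2 * s) = \<gamma> * N\<^sup>2 / (2 * s * N)"
        using N_pos s_pos by (simp add: power2_eq_square)
      also have "\<dots> = \<delta> * (pi / 2) / (sqrt \<delta> * \<sigma> / std_phi 0)"
        unfolding sN N2 using gamma_pos by simp
      also have "\<dots> = pi / 2 * f * (\<delta> / sqrt \<delta>)"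
        by (simp add: f_def mult_ac)
      finally show ?thesis using assms(2) by (simp add: real_div_sqrt)
    qed
    have "?M \<le> exp (a + b) * (1 - 547 / 1000 * (a + b)) * ?M"
      using exp_mult_linear_ge_1[of "a + b"] ab mult_right_mono[of 1 _ ?M] by simp
    also have "\<dots> \<le> exp X * ((1 - \<gamma> * L * (N\<^sup>2 / 3 + 57 / 100)) * ?M)"
      unfolding mult.assoc using k ab by (intro mult_mono mult_right_mono) auto
    also have "\<dots> \<le> exp X * (\<gamma> * cinf * N / (2 * s) + (\<integral>w. w \<partial>\<mu>) / (2 * s * N))"
      using measure_pos_le[OF N_pos N] by (intro mult_left_mono) auto
    also have "\<dots> \<le> exp X * (pi / 2 * f * sqrt \<delta> * cinf + f * (W * (1 + \<gamma>b * L) / sqrt \<delta>))"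
    proof (intro mult_left_mono add_mono)
      show "\<gamma> * cinf * N / (2 * s) \<le> pi / 2 * f * sqrt \<delta> * cinf"
      proof -
        have "\<gamma> * cinf * N / (2 * s) = cinf * (\<gamma> * N / (2 * s))" by simp
        then show ?thesis unfolding sN' by simp
      qed
      have "(\<integral>w. w \<partial>\<mu>) / (2 * s * N) \<le> W / (2 * s * N)"
        using EW s_pos N_pos by (intro divide_right_mono) auto
      also have "\<dots> = f * (W * 1 / sqrt \<delta>)"
        unfolding sN f_def by (simp add: mult_ac)
      also have "\<dots> \<le> f * (W * (1 + \<gamma>b * L) / sqrt \<delta>)"
        using f W pos L_nonneg assms(2) by (intro mult_left_mono divide_right_mono) auto
      finally show "(\<integral>w. w \<partial>\<mu>) / (2 * s * N) \<le> f * (W * (1 + \<gamma>b * L) / sqrt \<delta>)" .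
    qed auto
    also have "\<dots> \<le> cinf * const_c2 \<sigma> \<gamma>b L m R1 cinf \<delta>"
    proof -
      \<comment> \<open>One unit of \<open>pi / 2\<close> is the drift term of
        \<open>const_c2\<close>; the excess \<open>pi / 2 - 1\<close> is paid by its
        \<open>zeta\<close> term \<open>Z\<close>.\<close>
      have "exp X * (pi / 2 * f) \<le> exp X * f + Z * exp (3 * X)"
      proof -
        have "(pi / 2 - 1) * f * exp X \<le> Z * exp (3 * X)"
          using Z Z_nonneg pos by (intro mult_mono) auto
        then show ?thesis by (simp add: algebra_simps)
      qed
      then have "exp X * (pi / 2 * f) * (sqrt \<delta> * cinf) \<le> (exp X * f + Z * exp (3 * X)) * (?D * cinf)"
        using cinf_nonneg pos assms(2) f Z_nonneg by (intro mult_mono) auto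
      then show ?thesis
        unfolding c2 by (simp add: algebra_simps)
    qed
    finally show ?thesis .
  qed
qed

end

text \<open>The first moment is a nonnegative integral, so its bound also asserts finiteness; a
  Bochner integral would be 0 by default for a non-integrable identity.\<close>

theorem theorem11:
  fixes \<sigma> \<gamma>b cinf R1 L m \<delta> \<gamma> :: real
    and \<tau> :: "real \<Rightarrow> real \<Rightarrow> real"
    and \<mu> :: "real measure"
  assumes "\<sigma> > 0" and "\<gamma>b > 0" and "cinf \<ge> 0"
    and "R1 \<ge> 0" and "L \<ge> 0" and "m > 0"
    and tau_mono: "\<And>g. 0 < g \<Longrightarrow> g \<le> \<gamma>b \<Longrightarrow> mono_on {0..} (\<tau> g)"
    and tau_nonneg: "\<And>g r. 0 < g \<Longrightarrow> g \<le> \<gamma>b \<Longrightarrow> 0 \<le> r \<Longrightarrow> 0 \<le> \<tau> g r"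
    and tau_zero: "\<And>g. 0 < g \<Longrightarrow> g \<le> \<gamma>b \<Longrightarrow> \<tau> g 0 = 0"
    and tau_L: "\<And>g r. 0 < g \<Longrightarrow> g \<le> \<gamma>b \<Longrightarrow> 0 < r \<Longrightarrow> \<tau> g r / r \<le> 1 + g * L"
    and tau_m: "\<And>g r. 0 < g \<Longrightarrow> g \<le> \<gamma>b \<Longrightarrow> R1 < r \<Longrightarrow> \<tau> g r / r \<le> 1 - g * m"
    and "0 < \<delta>"
    and "L > 0 \<Longrightarrow> \<delta> \<le> 1 / L"
    and "cinf > 0 \<Longrightarrow> \<delta> \<le> (\<sigma> * exp (-1) / cinf)^2"
    and "0 < \<gamma>" and "\<gamma> \<le> \<gamma>b"
    and mu_inv: "invariant_prob \<sigma> cinf \<gamma> (\<tau> \<gamma>) \<mu>"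
    and mu_unique: "\<And>\<nu>. invariant_prob \<sigma> cinf \<gamma> (\<tau> \<gamma>) \<nu> \<Longrightarrow> \<nu> = \<mu>"
  shows "(\<integral>\<^sup>+ w. ennreal w \<partial>\<mu>) \<le> ennreal (cinf * const_c1 \<sigma> \<gamma>b L m R1 cinf \<delta>)
     \<and> measure \<mu> {0<..} \<le> cinf * const_c2 \<sigma> \<gamma>b L m R1 cinf \<delta>"
proof -
  interpret sticky_chain_bound \<sigma> cinf \<gamma> "\<tau> \<gamma>" \<mu> R1 L m
  proof
    show "\<tau> \<gamma> r \<le> (1 + \<gamma> * L) * r" if "0 \<le> r" for r
      using that tau_zero[of \<gamma>] tau_L[of \<gamma> r] assms(15,16)
      by (cases "r = 0") (auto simp: pos_divide_le_eq)
    show "\<tau> \<gamma> r \<le> (1 - \<gamma> * m) * r" if "R1 < r" for r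
      using that tau_m[of \<gamma> r] assms(4,15,16) by (simp add: pos_divide_le_eq)
  qed (use assms(1,3-6,15,16) tau_mono[of \<gamma>] tau_nonneg[of \<gamma>] mu_inv in simp_all)
  show ?thesis
    using first_moment_le_c1(1)[OF \<open>\<gamma> \<le> \<gamma>b\<close> \<open>0 < \<delta>\<close>] measure_pos_le_c2[OF \<open>\<gamma> \<le> \<gamma>b\<close> \<open>0 < \<delta>\<close> assms(13)]
    by blast
qed

end
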